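(* The topological conjugacy relation on the standard Borel space $\mathcal{T}^{**}_{\mathfrak{n}}$ of Toeplitz subshifts over $\mathfrak{n}$ having growing blocks with respect to the natural factorization of their scale is Borel reducible to $E_1$.
   Context: $\mathfrak{n}=\{0,\dots,\mathfrak{n}-1\}$, $\mathfrak{n}\ge2$; $\sigma$ is the left shift on $\mathfrak{n}^{\mathbb{Z}}$. A subshift is an infinite closed $O\subseteq\mathfrak{n}^{\mathbb{Z}}$ with $\sigma[O]=O$; subshifts $O,O'$ are topologically conjugate if there is a homeomorphism $O\to O'$ commuting with $\sigma$. $Per_p(\alpha)=\{i:\forall k\ \alpha(i+pk)=\alpha(i)\}$; $p$ is an essential period of $\alpha$ if $Per_p(\alpha)\neq\emptyset$ and $Per_p(\alpha)\ne Per_q(\alpha)$ for all $q<p$. A Toeplitz sequence is a non-periodic $\alpha$ with $\bigcup_pPer_p(\alpha)=\mathbb{Z}$; a Toeplitz subshift is the $\sigma$-orbit closure of a Toeplitz sequence. Supernatural numbers are formal products $\prod_{i\ge1}\mathrm{p}_i^{k_i}$ ($\mathrm{p}_i$ the $i$-th prime, $k_i\in\mathbb{N}\cup\{\infty\}$); the scale of a Toeplitz subshift $O$ is the supernatural number $\prod\mathrm{p}_i^{k_i}$ with $k_i=\sup\{j:\mathrm{p}_i^j$ divides some essential period of a (any) point of $O\}$. The natural factorization $(r_t)_{t\in\mathbb{N}}$ of $\mathbf{r}=\prod\mathrm{p}_i^{k_i}$ is obtained from $\dot r_t=\prod_{1\le i\le t+1}\mathrm{p}_i^{\min\{k_i,t+1\}}$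 by deleting all $1$'s and repeated terms; write $\tau(O)$ for the natural factorization of the scale of $O$. For $\alpha\in O$ and $p\in\mathbb{N}^+$, the $p$-skeleton of $\alpha$ replaces $\alpha(i)$ by a blank symbol for $i\notin Per_p(\alpha)$; a filled $p$-block is a maximal finite interval of indices in $Per_p(\alpha)$ (i.e. preceded and followed by blanks). $O$ has growing blocks with respect to $(u_i)$ if the minimal length of filled $u_i$-blocks in the $u_i$-skeleton of some (equivalently every) point of $O$ tends to $+\infty$ as $i\to\infty$ (minimum over an empty set being $+\infty$). $\mathcal{T}^{**}_{\mathfrak{n}}$ is the set of Toeplitz subshifts $O$ with growing blocks with respect to $\tau(O)$; it is a Borel subset of the hyperspace $K(\mathfrak{n}^{\mathbb{Z}})$ of nonempty compact sets with the Hausdorff metric topology, with the induced standard Borel structure. $E_1$ is the equivalence relation on $(2^{\mathbb{N}})^{\mathbb{N}}$ given by $x\,E_1\,y\iff\exists m\ \forall n\ge m\ x(n)=y(n)$; $\le_B$ denotes Borel reducibility. *)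

theory Defs
  imports "HOL-Analysis.Analysis" "HOL-Computational_Algebra.Primes"
begin

section \<open>The full shift and subshifts\<close>

text \<open>The usual metric on the natural numbers, compatible with their discrete topology. It makes
  the library's metric on countable products available for \<^typ>\<open>int \<Rightarrow> nat\<close>.\<close>

instantiation nat :: metric_space
begin

definition dist_nat :: "nat \<Rightarrow> nat \<Rightarrow> real" where
  "dist_nat m n = \<bar>real m - real n\<bar>"

definition uniformity_nat :: "(nat \<times> nat) filter" where
  "uniformity_nat = (INF e\<in>{0<..}. principal {(x, y). dist x y < e})"

instance
proof
  show "uniformity = (INF e\<in>{0<..}. principal {(x, y). dist (x::nat) y < e})"
    by (rule uniformity_nat_def)
  show "open U \<longleftrightarrow> (\<forall>x\<in>U. \<forall>\<^sub>F (x', y) in uniformity. x' = x \<longrightarrow> y \<in> U)" for U :: "nat set"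
  proof -
    have "\<forall>\<^sub>F (x', y) in uniformity. x' = x \<longrightarrow> y \<in> U" if "x \<in> U" for x
    proof -
      have "\<forall>\<^sub>F (x', y) in principal {(x, y). dist (x::nat) y < 1}. x' = x \<longrightarrow> y \<in> U"
      proof -
        have "a = b" if "dist a b < 1" for a b :: nat
          using that unfolding dist_nat_def by linarith
        then show ?thesis
          using that by (auto simp: eventually_principal)
      qed
      moreover have "uniformity \<le> principal {(x, y). dist (x::nat) y < 1}"
        unfolding uniformity_nat_def by (rule INF_lower) simp
      ultimately show ?thesis
        by (rule filter_leD[rotated])
    qed
    then show ?thesis by (simp add: open_discrete)
  qed
qed (auto simp: dist_nat_def)

end

text \<open>
  Bi-infinite sequences have type \<^typ>\<open>int \<Rightarrow> nat\<close>; the alphabet of size \<open>n\<close> is \<open>{..<n}\<close>.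
  The library topology on \<^typ>\<open>int \<Rightarrow> nat\<close> is the product of the discrete topologies, and
  its library metric induces this topology.
\<close>

definition full_shift :: "nat \<Rightarrow> (int \<Rightarrow> nat) set" where
  "full_shift n = {\<alpha>. range \<alpha> \<subseteq> {..<n}}"

definition shift :: "(int \<Rightarrow> nat) \<Rightarrow> (int \<Rightarrow> nat)" where
  "shift \<alpha> = (\<lambda>i. \<alpha> (i + 1))"

definition subshift :: "nat \<Rightarrow> (int \<Rightarrow> nat) set \<Rightarrow> bool" where
  "subshift n S \<longleftrightarrow> S \<subseteq> full_shift n \<and> infinite S \<and> closed S \<and> shift ` S = S"

definition top_conjugate :: "(int \<Rightarrow> nat) set \<Rightarrow> (int \<Rightarrow> nat) set \<Rightarrow> bool" where
  "top_conjugate S T \<longleftrightarrow>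
     (\<exists>f g. homeomorphism S T f g \<and> (\<forall>\<alpha>\<in>S. f (shift \<alpha>) = shift (f \<alpha>)))"

text \<open>The two-sided orbit: \<open>\<lambda>i. \<alpha> (i + k)\<close> is the \<open>k\<close>-th iterate of the shift, for
  \<open>k\<close> a possibly negative integer.\<close>

definition orbit :: "(int \<Rightarrow> nat) \<Rightarrow> (int \<Rightarrow> nat) set" where
  "orbit \<alpha> = range (\<lambda>k i. \<alpha> (i + k))"


section \<open>Toeplitz sequences and Toeplitz subshifts\<close>

text \<open>Periods are positive; \<open>Per 0 \<alpha>\<close> is all of the integers and is excluded in
  every definition below.\<close>

definition Per :: "nat \<Rightarrow> (int \<Rightarrow> nat) \<Rightarrow> int set" where
  "Per p \<alpha> = {i. \<forall>k::int. \<alpha> (i + int p * k) = \<alpha> i}"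

definition essential_period :: "(int \<Rightarrow> nat) \<Rightarrow> nat \<Rightarrow> bool" where
  "essential_period \<alpha> p \<longleftrightarrow>
     p > 0 \<and> Per p \<alpha> \<noteq> {} \<and> (\<forall>q. 0 < q \<and> q < p \<longrightarrow> Per p \<alpha> \<noteq> Per q \<alpha>)"

definition periodic_seq :: "(int \<Rightarrow> nat) \<Rightarrow> bool" where
  "periodic_seq \<alpha> \<longleftrightarrow> (\<exists>p>0. (shift ^^ p) \<alpha> = \<alpha>)"

definition toeplitz_seq :: "nat \<Rightarrow> (int \<Rightarrow> nat) \<Rightarrow> bool" where
  "toeplitz_seq n \<alpha> \<longleftrightarrow>
     \<alpha> \<in> full_shift n \<and> \<not> periodic_seq \<alpha> \<and> (\<Union>p\<in>{0<..}. Per p \<alpha>) = UNIV"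

definition toeplitz_subshift :: "nat \<Rightarrow> (int \<Rightarrow> nat) set \<Rightarrow> bool" where
  "toeplitz_subshift n S \<longleftrightarrow> (\<exists>\<alpha>. toeplitz_seq n \<alpha> \<and> S = closure (orbit \<alpha>))"


section \<open>Supernatural numbers, scale and natural factorization\<close>

text \<open>A supernatural number is given by its sequence of exponents. Indexing starts at \<open>0\<close>:
  \<open>k i\<close> is the exponent of \<open>nth_prime i\<close>, and \<open>nth_prime 0 = 2\<close>.\<close>

type_synonym supernatural = "nat \<Rightarrow> enat"

definition nth_prime :: "nat \<Rightarrow> nat" where
  "nth_prime = enumerate {p. prime p}"

text \<open>All points of a Toeplitz subshift have the same essential periods, so it does not matter
  which point is taken.\<close>

definition scale :: "(int \<Rightarrow> nat) set \<Rightarrow> supernatural" where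
  "scale S i =
     (SUP j\<in>{j. \<exists>\<alpha>\<in>S. \<exists>p. essential_period \<alpha> p \<and> nth_prime i ^ j dvd p}. enat j)"

definition pre_factorization :: "supernatural \<Rightarrow> nat \<Rightarrow> nat" where
  "pre_factorization k t = (\<Prod>i\<le>t. nth_prime i ^ the_enat (min (k i) (enat (t + 1))))"

text \<open>Only the indices of first occurrences of values other than \<open>1\<close> are kept. Infinitely many
  remain whenever \<open>k\<close> is not an ordinary natural number, in particular for the scale of a
  Toeplitz subshift.\<close>

definition natural_factorization :: "supernatural \<Rightarrow> nat \<Rightarrow> nat" where
  "natural_factorization k =
     pre_factorization k \<circ>
       enumerate {t. pre_factorization k t \<noteq> 1 \<and>
                     (\<forall>s<t. pre_factorization k s \<noteq> pre_factorization k t)}"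

definition tau :: "(int \<Rightarrow> nat) set \<Rightarrow> nat \<Rightarrow> nat" where
  "tau S = natural_factorization (scale S)"


section \<open>Growing blocks\<close>

definition skeleton :: "nat \<Rightarrow> (int \<Rightarrow> nat) \<Rightarrow> int \<Rightarrow> nat option" where
  "skeleton p \<alpha> i = (if i \<in> Per p \<alpha> then Some (\<alpha> i) else None)"

text \<open>The pair \<open>(a, b)\<close> stands for the nonempty interval \<open>{a..b}\<close>.\<close>

definition filled_blocks :: "nat \<Rightarrow> (int \<Rightarrow> nat) \<Rightarrow> (int \<times> int) set" where
  "filled_blocks p \<alpha> =
     {(a, b). a \<le> b \<and> (\<forall>i\<in>{a..b}. skeleton p \<alpha> i \<noteq> None) \<and>
              skeleton p \<alpha> (a - 1) = None \<and> skeleton p \<alpha> (b + 1) = None}"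

definition min_block_length :: "nat \<Rightarrow> (int \<Rightarrow> nat) \<Rightarrow> enat" where
  "min_block_length p \<alpha> = (INF (a, b)\<in>filled_blocks p \<alpha>. enat (card {a..b}))"

definition growing_blocks :: "(nat \<Rightarrow> nat) \<Rightarrow> (int \<Rightarrow> nat) set \<Rightarrow> bool" where
  "growing_blocks u S \<longleftrightarrow>
     (\<exists>\<alpha>\<in>S. (\<lambda>t. min_block_length (u t) \<alpha>) \<longlonglongrightarrow> \<infinity>)"

definition toeplitz_growing :: "nat \<Rightarrow> (int \<Rightarrow> nat) set set" where
  "toeplitz_growing n = {S. toeplitz_subshift n S \<and> growing_blocks (tau S) S}"


section \<open>The hyperspace of compact sets and Borel reducibility\<close>

text \<open>Outside the nonempty compact sets the suprema need not exist; the value \<open>0\<close> there is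
  irrelevant, but makes the function nonnegative everywhere, as \<^locale>\<open>Metric_space\<close>
  demands.\<close>

definition hausdorff_dist :: "'a::metric_space set \<Rightarrow> 'a set \<Rightarrow> real" where
  "hausdorff_dist A B =
     (if A \<noteq> {} \<and> compact A \<and> B \<noteq> {} \<and> compact B
      then max (SUP a\<in>A. infdist a B) (SUP b\<in>B. infdist b A) else 0)"

definition compacts :: "'a::metric_space set \<Rightarrow> 'a set set" where
  "compacts X = {A. A \<subseteq> X \<and> A \<noteq> {} \<and> compact A}"

definition hyperspace :: "'a::metric_space set \<Rightarrow> 'a set topology" where
  "hyperspace X = Metric_space.mtopology (compacts X) hausdorff_dist"

definition borel_of :: "'a topology \<Rightarrow> 'a measure" where
  "borel_of X = sigma (topspace X) {U. openin X U}"

definition toeplitz_growing_space :: "nat \<Rightarrow> (int \<Rightarrow> nat) set measure" where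
  "toeplitz_growing_space n =
     restrict_space (borel_of (hyperspace (full_shift n))) (toeplitz_growing n)"

definition borel_reducible ::
    "'a measure \<Rightarrow> ('a \<Rightarrow> 'a \<Rightarrow> bool) \<Rightarrow> 'b measure \<Rightarrow> ('b \<Rightarrow> 'b \<Rightarrow> bool) \<Rightarrow> bool" where
  "borel_reducible M E N F \<longleftrightarrow>
     (\<exists>f\<in>measurable M N. \<forall>x\<in>space M. \<forall>y\<in>space M. E x y \<longleftrightarrow> F (f x) (f y))"

definition E1 :: "(nat \<Rightarrow> nat \<Rightarrow> bool) \<Rightarrow> (nat \<Rightarrow> nat \<Rightarrow> bool) \<Rightarrow> bool" where
  "E1 x y \<longleftrightarrow> (\<exists>m. \<forall>n\<ge>m. x n = y n)"


section \<open>Well-definedness\<close>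

lemma bdd_above_infdist:
  fixes A B :: "'a::metric_space set"
  assumes "compact A"
  shows "bdd_above ((\<lambda>a. infdist a B) ` A)"
proof -
  have "compact ((\<lambda>a. infdist a B) ` A)"
    by (intro compact_continuous_image continuous_intros assms)
  then show ?thesis
    by (intro bounded_imp_bdd_above compact_imp_bounded)
qed

lemma infdist_le_hausdorff_dist:
  assumes "A \<in> compacts X" "B \<in> compacts X" "a \<in> A"
  shows "infdist a B \<le> hausdorff_dist A B"
proof -
  have "infdist a B \<le> (SUP a\<in>A. infdist a B)"
    using assms by (intro cSUP_upper bdd_above_infdist) (auto simp: compacts_def)
  then show ?thesis
    using assms by (auto simp: hausdorff_dist_def compacts_def)
qed

lemma hausdorff_dist_commute: "hausdorff_dist A B = hausdorff_dist B A"
  by (auto simp: hausdorff_dist_def max.commute)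

lemma hausdorff_dist_leI:
  assumes "A \<in> compacts X" "B \<in> compacts X"
    and "\<And>a. a \<in> A \<Longrightarrow> infdist a B \<le> r" "\<And>b. b \<in> B \<Longrightarrow> infdist b A \<le> r"
  shows "hausdorff_dist A B \<le> r"
  using assms by (auto simp: hausdorff_dist_def compacts_def intro!: cSUP_least)

lemma infdist_le_add_hausdorff_dist:
  assumes "A \<in> compacts X" "B \<in> compacts X" "C \<in> compacts X" "a \<in> A"
  shows "infdist a C \<le> hausdorff_dist A B + hausdorff_dist B C"
proof -
  have "infdist a C - hausdorff_dist B C \<le> dist a b" if "b \<in> B" for b
    using infdist_triangle[of a C b] infdist_le_hausdorff_dist[OF assms(2,3) that] by simp
  then have "infdist a C - hausdorff_dist B C \<le> infdist a B"
    using assms(2) by (auto simp: infdist_notempty compacts_def intro!: cINF_greatest)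
  then show ?thesis
    using infdist_le_hausdorff_dist[OF assms(1,2,4)] by simp
qed

lemma Metric_space_hausdorff_dist: "Metric_space (compacts X) hausdorff_dist"
proof
  show "0 \<le> hausdorff_dist A B" for A B :: "'a set"
  proof (cases "A \<noteq> {} \<and> compact A \<and> B \<noteq> {} \<and> compact B")
    case True
    then obtain a where "a \<in> A" by blast
    then show ?thesis
      using True infdist_le_hausdorff_dist[of A UNIV B a] infdist_nonneg[of a B]
      by (auto simp: compacts_def)
  qed (auto simp: hausdorff_dist_def)
  show "hausdorff_dist A B = hausdorff_dist B A" for A B :: "'a set"
    by (rule hausdorff_dist_commute)
next
  fix A B :: "'a set"
  assume AB: "A \<in> compacts X" "B \<in> compacts X"
  have sub: "C \<subseteq> D" if "C \<in> compacts X" "D \<in> compacts X" "hausdorff_dist C D = 0"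
    for C D :: "'a set"
  proof
    fix c assume "c \<in> C"
    then have "infdist c D = 0"
      using infdist_le_hausdorff_dist[OF that(1,2)] that(3) infdist_nonneg[of c D]
      by fastforce
    then show "c \<in> D"
      using that(2) by (auto simp: compacts_def compact_imp_closed in_closed_iff_infdist_zero)
  qed
  show "hausdorff_dist A B = 0 \<longleftrightarrow> A = B"
  proof
    assume "hausdorff_dist A B = 0"
    then show "A = B"
      using sub[OF AB] sub[OF AB(2,1)] by (simp add: hausdorff_dist_commute)
  next
    assume "A = B"
    then show "hausdorff_dist A B = 0"
      using AB by (auto simp: hausdorff_dist_def compacts_def)
  qed
next
  fix A B C :: "'a set"
  assume ABC: "A \<in> compacts X" "B \<in> compacts X" "C \<in> compacts X"
  show "hausdorff_dist A C \<le> hausdorff_dist A B + hausdorff_dist B C"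
    using infdist_le_add_hausdorff_dist[OF ABC] infdist_le_add_hausdorff_dist[OF ABC(3,2,1)]
    by (intro hausdorff_dist_leI[OF ABC(1,3)]) (simp_all add: hausdorff_dist_commute add.commute)
qed

lemma compact_full_shift: "compact (full_shift n)"
proof -
  have eq: "full_shift n = PiE UNIV (\<lambda>_. {..<n})"
    by (auto simp: full_shift_def PiE_def)
  have "compactin (product_topology (\<lambda>_. euclidean) UNIV) (PiE (UNIV :: int set) (\<lambda>_. {..<n}))"
    by (simp add: compactin_PiE finite_imp_compact)
  then show ?thesis
    by (simp add: eq euclidean_product_topology)
qed

lemma continuous_shift: "continuous_on UNIV (\<lambda>\<alpha>::int \<Rightarrow> nat. \<lambda>i. \<alpha> (i + k))"
  by (intro continuous_on_coordinatewise_then_product continuous_on_product_coordinates)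

lemma shift_orbit: "(\<lambda>\<beta> i. \<beta> (i + k)) ` orbit \<alpha> = orbit \<alpha>"
proof -
  have "(\<lambda>i. \<alpha> (i + j)) \<in> (\<lambda>\<beta> i. \<beta> (i + k)) ` orbit \<alpha>" for j
    by (rule image_eqI[of _ _ "\<lambda>i. \<alpha> (i + (j - k))"]) (auto simp: orbit_def)
  moreover have "(\<lambda>i. \<alpha> (i + k + j)) \<in> orbit \<alpha>" for j
    unfolding orbit_def by (rule range_eqI[of _ _ "k + j"]) (simp add: add.assoc)
  ultimately show ?thesis
    by (auto simp: orbit_def)
qed

lemma funpow_shift: "(shift ^^ p) \<alpha> = (\<lambda>i. \<alpha> (i + int p))"
  by (induction p) (auto simp: shift_def add_ac)

lemma subshift_toeplitz:
  assumes "toeplitz_subshift n S"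
  shows "subshift n S"
proof -
  obtain \<alpha> where \<alpha>: "toeplitz_seq n \<alpha>" and S: "S = closure (orbit \<alpha>)"
    using assms by (auto simp: toeplitz_subshift_def)
  have "orbit \<alpha> \<subseteq> full_shift n"
    using \<alpha> by (auto simp: toeplitz_seq_def orbit_def full_shift_def)
  then have sub: "S \<subseteq> full_shift n"
    unfolding S by (intro closure_minimal compact_imp_closed compact_full_shift)
  have "inj (\<lambda>k i. \<alpha> (i + k))"
  proof (rule linorder_injI)
    fix x y :: int
    assume "x < y"
    show "(\<lambda>i. \<alpha> (i + x)) \<noteq> (\<lambda>i. \<alpha> (i + y))"
    proof
      assume eq: "(\<lambda>i. \<alpha> (i + x)) = (\<lambda>i. \<alpha> (i + y))"
      have "(shift ^^ nat (y - x)) \<alpha> = \<alpha>"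
      proof
        fix i
        have "\<alpha> ((i - x) + x) = \<alpha> ((i - x) + y)" using fun_cong[OF eq] .
        then show "(shift ^^ nat (y - x)) \<alpha> i = \<alpha> i"
          using \<open>x < y\<close> by (simp add: funpow_shift algebra_simps)
      qed
      moreover have "nat (y - x) > 0" using \<open>x < y\<close> by simp
      ultimately show False
        using \<alpha> unfolding toeplitz_seq_def periodic_seq_def by blast
    qed
  qed
  then have "infinite (orbit \<alpha>)"
    unfolding orbit_def by (simp add: finite_image_iff)
  then have inf: "infinite S"
    unfolding S by (meson closure_subset finite_subset)
  have inv: "(\<lambda>\<beta> i. \<beta> (i + k)) ` S \<subseteq> S" for k
  proof -
    have "(\<lambda>\<beta> i. \<beta> (i + k)) ` closure (orbit \<alpha>) \<subseteq> closure ((\<lambda>\<beta> i. \<beta> (i + k)) ` orbit \<alpha>)"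
      by (intro image_closure_subset continuous_on_subset[OF continuous_shift])
         (auto intro: closure_subset[THEN subsetD])
    then show ?thesis
      by (simp add: S shift_orbit)
  qed
  have "shift ` S = S"
  proof
    show "shift ` S \<subseteq> S"
      using inv[of 1] by (simp add: shift_def[abs_def])
    show "S \<subseteq> shift ` S"
    proof
      fix \<beta> assume "\<beta> \<in> S"
      then have "(\<lambda>i. \<beta> (i + - 1)) \<in> S" using inv[of "-1"] by blast
      moreover have "\<beta> = shift (\<lambda>i. \<beta> (i + - 1))" by (simp add: shift_def)
      ultimately show "\<beta> \<in> shift ` S" by blast
    qed
  qed
  with sub inf show ?thesis
    by (simp add: subshift_def S)
qed

lemma toeplitz_growing_subset: "toeplitz_growing n \<subseteq> compacts (full_shift n)"
proof
  fix S assume "S \<in> toeplitz_growing n"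
  then have "subshift n S"
    by (simp add: toeplitz_growing_def subshift_toeplitz)
  then show "S \<in> compacts (full_shift n)"
    using closed_Int_compact[OF _ compact_full_shift, of S n]
    by (auto simp: subshift_def compacts_def Int_absorb2)
qed

lemma space_toeplitz_growing_space: "space (toeplitz_growing_space n) = toeplitz_growing n"
proof -
  interpret Metric_space "compacts (full_shift n)" hausdorff_dist
    by (rule Metric_space_hausdorff_dist)
  have "space (borel_of (hyperspace (full_shift n))) = compacts (full_shift n)"
    by (simp add: borel_of_def hyperspace_def openin_subset space_measure_of_conv)
  then show ?thesis
    using toeplitz_growing_subset[of n]
    by (auto simp: toeplitz_growing_space_def space_restrict_space)
qed

end

theory Submission
  imports Defs
begin

text \<open>
  A conjugacy between Toeplitz subshifts is, on any point \<open>\<alpha>\<close> and its image \<open>\<beta>\<close>, a pair of mutually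
  inverse sliding block codes of some radius \<open>r\<close>. Let \<open>p\<close> run through the terms of the natural
  factorization of the scale. If the filled \<open>p\<close>-blocks are long compared with \<open>r\<close>, then those of \<open>\<alpha>\<close>
  and \<open>\<beta>\<close> have ends at distance at most \<open>r\<close>, so their midpoints correspond up to \<open>r\<close>; cutting at
  corresponding midpoints, the code induces a bijection of the words of length \<open>p\<close> that occur in the
  two cut sequences, because the values read across a cut are \<open>p\<close>-periodic. Hence the set of finite
  patterns of equalities between \<open>p\<close>-words, over all cuts at midpoints of filled \<open>p\<close>-blocks, is for
  almost all \<open>p\<close> the same for both subshifts. Conversely, if these sets coincide for a single \<open>p\<close> and
  are nonempty, compactness gives points of the two subshifts with the same infinite pattern; since a
  long enough window determines its position modulo \<open>p\<close>, each of these points is a sliding block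
  image of the other. All these sets can be computed from any one point of the subshift, and the
  lexicographically least point depends on the subshift in a Borel way.
\<close>

section \<open>Cylinders and orbit closures\<close>

text \<open>Comparing windows at two positions, possibly of the same sequence, treats cylinders,
  recurrence and the inputs of block codes alike.\<close>

definition agree :: "int \<Rightarrow> (int \<Rightarrow> 'a) \<Rightarrow> int \<Rightarrow> (int \<Rightarrow> 'a) \<Rightarrow> int \<Rightarrow> bool" where
  "agree r \<alpha> k \<beta> l \<longleftrightarrow> (\<forall>j. \<bar>j\<bar> \<le> r \<longrightarrow> \<alpha> (k + j) = \<beta> (l + j))"

lemma agreeD: "agree r \<alpha> k \<beta> l \<Longrightarrow> \<bar>j\<bar> \<le> r \<Longrightarrow> \<alpha> (k + j) = \<beta> (l + j)"
  by (simp add: agree_def)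

lemma agree_sym: "agree r \<alpha> k \<beta> l \<Longrightarrow> agree r \<beta> l \<alpha> k"
  by (simp add: agree_def)

lemma agree_trans: "agree r \<alpha> k \<beta> l \<Longrightarrow> agree r \<beta> l \<gamma> m \<Longrightarrow> agree r \<alpha> k \<gamma> m"
  by (simp add: agree_def)

lemma agree_mono: "agree r \<alpha> k \<beta> l \<Longrightarrow> s \<le> r \<Longrightarrow> agree s \<alpha> k \<beta> l"
  by (auto simp: agree_def)

lemma agree_translate:
  assumes "agree r \<alpha> k \<beta> l" "s + \<bar>d\<bar> \<le> r"
  shows "agree s \<alpha> (k + d) \<beta> (l + d)"
  unfolding agree_def
proof (intro allI impI)
  fix j :: int assume "\<bar>j\<bar> \<le> s"
  then have "\<bar>d + j\<bar> \<le> r" using assms(2) by linarith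
  from agreeD[OF assms(1) this] show "\<alpha> (k + d + j) = \<beta> (l + d + j)" by (simp add: add.assoc)
qed

lemma open_cylinder: "open {\<delta> :: int \<Rightarrow> nat. agree r \<delta> 0 \<gamma> k}"
proof -
  have "{\<delta> :: int \<Rightarrow> nat. agree r \<delta> 0 \<gamma> k} = (\<Inter>j\<in>{-r..r}. (\<lambda>\<delta>. \<delta> j) -` {\<gamma> (k + j)})"
    by (auto simp: agree_def abs_le_iff)
  moreover have "open ((\<lambda>\<delta> :: int \<Rightarrow> nat. \<delta> j) -` {\<gamma> (k + j)})" for j
    by (intro open_vimage open_discrete continuous_on_product_coordinates)
  ultimately show ?thesis by auto
qed

text \<open>A basic open set of the product constrains only finitely many coordinates, and a large
  enough window contains them all.\<close>

lemma open_contains_cylinder: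
  fixes U :: "(int \<Rightarrow> nat) set"
  assumes "open U" "\<gamma> \<in> U"
  shows "\<exists>r. \<forall>\<delta>. agree r \<delta> 0 \<gamma> 0 \<longrightarrow> \<delta> \<in> U"
proof -
  have "openin (product_topology (\<lambda>_. euclidean) UNIV) U"
    using assms(1) by (simp add: euclidean_product_topology)
  from product_topology_open_contains_basis[OF this assms(2)] obtain X where
    X: "\<gamma> \<in> (\<Pi>\<^sub>E i\<in>UNIV. X i)" "finite {i. X i \<noteq> UNIV}" "(\<Pi>\<^sub>E i\<in>UNIV. X i) \<subseteq> U"
    by auto
  obtain r where r: "\<bar>i\<bar> \<le> r" if "X i \<noteq> UNIV" for i
  proof
    show "\<bar>i\<bar> \<le> Max (abs ` {i. X i \<noteq> UNIV})" if "X i \<noteq> UNIV" for i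
      using X(2) that by (intro Max_ge finite_imageI imageI) auto
  qed
  have "\<delta> \<in> U" if "agree r \<delta> 0 \<gamma> 0" for \<delta>
  proof (rule subsetD[OF X(3)], rule PiE_I)
    fix i show "\<delta> i \<in> X i"
      using X(1) r[of i] agreeD[OF that, of i] by (cases "X i = UNIV") (auto simp: PiE_iff)
  qed auto
  then show ?thesis by blast
qed

lemma closure_iff_agree:
  "\<gamma> \<in> closure S \<longleftrightarrow> (\<forall>r. \<exists>\<delta>\<in>S. agree r \<gamma> 0 \<delta> 0)" for \<gamma> :: "int \<Rightarrow> nat"
proof
  assume L: "\<gamma> \<in> closure S"
  show "\<forall>r. \<exists>\<delta>\<in>S. agree r \<gamma> 0 \<delta> 0"
  proof
    fix r
    have "\<gamma> \<in> {\<delta>. agree r \<delta> 0 \<gamma> 0}" by (simp add: agree_def)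
    then have "S \<inter> {\<delta>. agree r \<delta> 0 \<gamma> 0} \<noteq> {}"
      using L open_cylinder[of r \<gamma> 0] unfolding closure_iff_nhds_not_empty by blast
    then show "\<exists>\<delta>\<in>S. agree r \<gamma> 0 \<delta> 0" using agree_sym by blast
  qed
next
  assume R: "\<forall>r. \<exists>\<delta>\<in>S. agree r \<gamma> 0 \<delta> 0"
  show "\<gamma> \<in> closure S"
    unfolding closure_iff_nhds_not_empty
  proof (intro allI impI)
    fix A V assume "V \<subseteq> A" "open V" "\<gamma> \<in> V"
    then show "S \<inter> A \<noteq> {}"
      using open_contains_cylinder[of V \<gamma>] R agree_sym by blast
  qed
qed

lemma closure_orbit_iff_agree:
  "\<gamma> \<in> closure (orbit \<alpha>) \<longleftrightarrow> (\<forall>r. \<exists>k. agree r \<gamma> 0 \<alpha> k)"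
proof -
  have "agree r \<gamma> 0 (\<lambda>i. \<alpha> (i + k)) 0 \<longleftrightarrow> agree r \<gamma> 0 \<alpha> k" for r k
    by (simp add: agree_def add.commute)
  then show ?thesis by (simp add: closure_iff_agree orbit_def)
qed

lemma tendsto_iff_eventually_agree:
  "(X \<longlongrightarrow> \<gamma>) F \<longleftrightarrow> (\<forall>r. \<forall>\<^sub>F m in F. agree r (X m) 0 \<gamma> 0)" for \<gamma> :: "int \<Rightarrow> nat"
proof
  assume L: "(X \<longlongrightarrow> \<gamma>) F"
  show "\<forall>r. \<forall>\<^sub>F m in F. agree r (X m) 0 \<gamma> 0"
    using topological_tendstoD[OF L open_cylinder[of _ \<gamma> 0]] by (simp add: agree_def)
next
  assume R: "\<forall>r. \<forall>\<^sub>F m in F. agree r (X m) 0 \<gamma> 0"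
  show "(X \<longlongrightarrow> \<gamma>) F"
  proof (rule topological_tendstoI)
    fix S assume "open S" "\<gamma> \<in> S"
    then obtain r where "\<forall>\<delta>. agree r \<delta> 0 \<gamma> 0 \<longrightarrow> \<delta> \<in> S"
      using open_contains_cylinder by blast
    then show "\<forall>\<^sub>F m in F. X m \<in> S" using R by (blast intro: eventually_mono)
  qed
qed

lemma compact_limit_point:
  fixes S :: "(int \<Rightarrow> nat) set"
  assumes "compact S" "\<And>m::nat. X m \<in> S"
  shows "\<exists>\<beta>\<in>S. \<exists>h. strict_mono h \<and> (\<forall>r. \<forall>\<^sub>F m in sequentially. agree r (X (h m)) 0 \<beta> 0)"
proof -
  have "seq_compact S" using assms(1) by (simp add: compact_eq_seq_compact_metric)
  then obtain \<beta> h where "\<beta> \<in> S" "strict_mono h" "(X \<circ> h) \<longlonglongrightarrow> \<beta>"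
    using assms(2) by (meson seq_compactE)
  then show ?thesis by (auto simp: tendsto_iff_eventually_agree)
qed

lemma translate_mem_closure_orbit:
  "w \<in> closure (orbit \<alpha>) \<Longrightarrow> (\<lambda>i. w (i + k)) \<in> closure (orbit \<alpha>)"
  unfolding closure_orbit_iff_agree
proof
  fix r assume *: "\<forall>r. \<exists>k. agree r w 0 \<alpha> k"
  then obtain l where "agree (r + \<bar>k\<bar>) w 0 \<alpha> l" by blast
  from agree_translate[OF this, of r k] have "agree r w k \<alpha> (l + k)" by simp
  then have "agree r (\<lambda>i. w (i + k)) 0 \<alpha> (l + k)" by (simp add: agree_def add_ac)
  then show "\<exists>l. agree r (\<lambda>i. w (i + k)) 0 \<alpha> l" ..
qed

section \<open>Conjugacies as local codes\<close>

text \<open>A sliding block code of radius \<open>r\<close> carrying \<alpha> to \<beta>, given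
  without a map on words: only windows that occur in \<alpha> are constrained.\<close>

definition local_code :: "int \<Rightarrow> (int \<Rightarrow> nat) \<Rightarrow> (int \<Rightarrow> nat) \<Rightarrow> bool" where
  "local_code r \<alpha> \<beta> \<longleftrightarrow> (\<forall>k l. agree r \<alpha> k \<alpha> l \<longrightarrow> \<beta> k = \<beta> l)"

lemma local_code_mono: "local_code r \<alpha> \<beta> \<Longrightarrow> r \<le> s \<Longrightarrow> local_code s \<alpha> \<beta>"
  by (auto simp: local_code_def dest: agree_mono)

text \<open>The compactness step of the Curtis-Hedlund-Lyndon theorem: pairs that agree on ever
  larger windows but have images differing at 0 would have a common limit along a subsequence, and
  continuity there makes the images agree at 0.\<close>

lemma continuous_code_radius:
  fixes f :: "(int \<Rightarrow> nat) \<Rightarrow> (int \<Rightarrow> nat)"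
  assumes "compact S" "continuous_on S f"
  shows "\<exists>r. \<forall>v\<in>S. \<forall>w\<in>S. agree r v 0 w 0 \<longrightarrow> f v 0 = f w 0"
proof (rule ccontr)
  assume "\<not> ?thesis"
  then have ex: "\<exists>v\<in>S. \<exists>w\<in>S. agree r v 0 w 0 \<and> f v 0 \<noteq> f w 0" for r
    by simp
  have "\<exists>u. fst u \<in> S \<and> snd u \<in> S \<and> agree (int m) (fst u) 0 (snd u) 0 \<and> f (fst u) 0 \<noteq> f (snd u) 0"
    for m
  proof -
    from ex[of "int m"] obtain v w where "v \<in> S" "w \<in> S" "agree (int m) v 0 w 0" "f v 0 \<noteq> f w 0"
      by auto
    then show ?thesis by (intro exI[of _ "(v, w)"]) simp
  qed
  then have "\<exists>U. \<forall>m. fst (U m) \<in> S \<and> snd (U m) \<in> S \<and>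
      agree (int m) (fst (U m)) 0 (snd (U m)) 0 \<and> f (fst (U m)) 0 \<noteq> f (snd (U m)) 0"
    by (intro choice allI)
  then obtain U where U: "\<forall>m. fst (U m) \<in> S \<and> snd (U m) \<in> S \<and>
      agree (int m) (fst (U m)) 0 (snd (U m)) 0 \<and> f (fst (U m)) 0 \<noteq> f (snd (U m)) 0"
    by (rule exE)
  define V where "V = fst \<circ> U"
  define W where "W = snd \<circ> U"
  have VW: "\<And>m. V m \<in> S" "\<And>m. W m \<in> S"
    "\<And>m. agree (int m) (V m) 0 (W m) 0" "\<And>m. f (V m) 0 \<noteq> f (W m) 0"
    using U by (simp_all add: V_def W_def)
  obtain \<beta> h where \<beta>: "\<beta> \<in> S" "strict_mono h"
      and lim: "\<And>r. \<forall>\<^sub>F m in sequentially. agree r (V (h m)) 0 \<beta> 0"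
    using compact_limit_point[of S V, OF assms(1) VW(1)] by metis
  have lim': "\<forall>\<^sub>F m in sequentially. agree r (W (h m)) 0 \<beta> 0" for r
    using lim[of r] eventually_ge_at_top[of "nat r"]
  proof eventually_elim
    case (elim m)
    have "h m \<ge> m" by (rule seq_suble[OF \<beta>(2)])
    then have "agree r (V (h m)) 0 (W (h m)) 0" using VW(3)[of "h m"] elim by (auto intro: agree_mono)
    with elim show ?case using agree_sym agree_trans by blast
  qed
  have tends: "\<forall>\<^sub>F m in sequentially. agree 0 (f (Z (h m))) 0 (f \<beta>) 0"
    if "\<And>m. Z m \<in> S" "\<And>r. \<forall>\<^sub>F m in sequentially. agree r (Z (h m)) 0 \<beta> 0" for Z
  proof -
    have "(\<lambda>m. Z (h m)) \<longlonglongrightarrow> \<beta>" using that(2) by (simp add: tendsto_iff_eventually_agree)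
    from continuous_on_tendsto_compose[OF assms(2) this \<beta>(1)] that(1)
    have "(\<lambda>m. f (Z (h m))) \<longlonglongrightarrow> f \<beta>" by simp
    then show ?thesis unfolding tendsto_iff_eventually_agree by blast
  qed
  from tends[OF VW(1) lim] tends[OF VW(2) lim']
  have "\<forall>\<^sub>F m in sequentially. False"
  proof eventually_elim
    case (elim m)
    then show False using VW(4)[of "h m"] by (simp add: agree_def)
  qed
  then show False by simp
qed

lemma conjugacy_translate:
  assumes comm: "\<And>\<alpha>. \<alpha> \<in> closure (orbit \<gamma>) \<Longrightarrow> f (shift \<alpha>) = shift (f \<alpha>)"
    and \<alpha>: "\<alpha> \<in> closure (orbit \<gamma>)"
  shows "f (\<lambda>i. \<alpha> (i + k)) = (\<lambda>i. f \<alpha> (i + k))"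
proof -
  have nonneg: "f (\<lambda>i. w (i + int m)) = (\<lambda>i. f w (i + int m))"
    if w: "w \<in> closure (orbit \<gamma>)" for w m
  proof (induction m)
    case (Suc m)
    have "(\<lambda>i. w (i + int (Suc m))) = shift (\<lambda>i. w (i + int m))"
      by (simp add: shift_def add_ac)
    then show ?case
      using comm[OF translate_mem_closure_orbit[OF w, of "int m"]] Suc
      by (simp add: shift_def add_ac)
  qed simp
  show ?thesis
  proof (cases "k \<ge> 0")
    case True
    then show ?thesis using nonneg[OF \<alpha>, of "nat k"] by simp
  next
    case False
    \<comment> \<open>Shifting the translate forward by \<open>- k\<close> steps returns \<alpha>,
      so the forward case can be solved for the image of the translate.\<close>
    have "f \<alpha> = (\<lambda>i. f (\<lambda>i. \<alpha> (i + k)) (i - k))"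
      using nonneg[OF translate_mem_closure_orbit[OF \<alpha>, of k], of "nat (- k)"] False by simp
    then have "f \<alpha> (i + k) = f (\<lambda>i. \<alpha> (i + k)) i" for i by (metis add_diff_cancel_right')
    then show ?thesis by simp
  qed
qed

lemma conjugacy_local_code:
  assumes "compact (closure (orbit \<gamma>))" "continuous_on (closure (orbit \<gamma>)) f"
    and "\<And>\<alpha>. \<alpha> \<in> closure (orbit \<gamma>) \<Longrightarrow> f (shift \<alpha>) = shift (f \<alpha>)"
    and "\<alpha> \<in> closure (orbit \<gamma>)"
  shows "\<exists>r. local_code r \<alpha> (f \<alpha>)"
proof -
  obtain r where r: "\<And>v w. v \<in> closure (orbit \<gamma>) \<Longrightarrow> w \<in> closure (orbit \<gamma>) \<Longrightarrow>
      agree r v 0 w 0 \<Longrightarrow> f v 0 = f w 0"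
    using continuous_code_radius[OF assms(1,2)] by blast
  have "f \<alpha> k = f \<alpha> l" if "agree r \<alpha> k \<alpha> l" for k l
  proof -
    have "agree r (\<lambda>i. \<alpha> (i + k)) 0 (\<lambda>i. \<alpha> (i + l)) 0"
      using that by (simp add: agree_def add_ac)
    from r[OF translate_mem_closure_orbit translate_mem_closure_orbit this] show ?thesis
      using assms(4) conjugacy_translate[of \<gamma> f \<alpha>, OF assms(3)] by simp
  qed
  then show ?thesis unfolding local_code_def by blast
qed

text \<open>The block code read off from \<alpha> and \<beta>, applied to \<open>w\<close>: look up
  an occurrence in \<alpha> of the window at \<open>x\<close>. Under \<open>local_code\<close> the
  choice of the occurrence is immaterial.\<close>

definition extend_code :: "int \<Rightarrow> (int \<Rightarrow> nat) \<Rightarrow> (int \<Rightarrow> nat) \<Rightarrow> (int \<Rightarrow> nat) \<Rightarrow> int \<Rightarrow> nat" where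
  "extend_code r \<alpha> \<beta> w x = \<beta> (SOME k. agree r w x \<alpha> k)"

lemma extend_code_eq:
  assumes "local_code r \<alpha> \<beta>" "agree r w x \<alpha> k"
  shows "extend_code r \<alpha> \<beta> w x = \<beta> k"
proof -
  have "agree r w x \<alpha> (SOME k. agree r w x \<alpha> k)" using assms(2) by (rule someI)
  then have "agree r \<alpha> (SOME k. agree r w x \<alpha> k) \<alpha> k"
    using assms(2) agree_sym agree_trans by blast
  then show ?thesis using assms(1) by (simp add: local_code_def extend_code_def)
qed

lemma agree_extend_code:
  assumes "local_code r \<alpha> \<beta>" "agree (N + r) w 0 \<alpha> k"
  shows "agree N (extend_code r \<alpha> \<beta> w) 0 \<beta> k"
  unfolding agree_def
proof (intro allI impI)
  fix j :: int assume "\<bar>j\<bar> \<le> N"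
  then have "agree r w (0 + j) \<alpha> (k + j)" by (intro agree_translate[OF assms(2)]) simp
  then show "extend_code r \<alpha> \<beta> w (0 + j) = \<beta> (k + j)" by (rule extend_code_eq[OF assms(1)])
qed

lemma extend_code_mem:
  assumes "local_code r \<alpha> \<beta>" "w \<in> closure (orbit \<alpha>)"
  shows "extend_code r \<alpha> \<beta> w \<in> closure (orbit \<beta>)"
  using assms(2) agree_extend_code[OF assms(1)] unfolding closure_orbit_iff_agree by meson

lemma extend_code_inverse:
  assumes "local_code r \<alpha> \<beta>" "local_code s \<beta> \<alpha>" "w \<in> closure (orbit \<alpha>)"
  shows "extend_code s \<beta> \<alpha> (extend_code r \<alpha> \<beta> w) = w"
proof
  fix x
  \<comment> \<open>The two codes shorten the window by \<open>r\<close> and \<open>s\<close>; the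
    absolute values keep it large enough to contain \<open>x\<close> whatever the signs of the
    radii.\<close>
  obtain k where k: "agree (\<bar>x\<bar> + s + r + \<bar>r\<bar> + \<bar>s\<bar>) w 0 \<alpha> k"
    using assms(3) unfolding closure_orbit_iff_agree by blast
  have "agree (\<bar>x\<bar> + s) (extend_code r \<alpha> \<beta> w) 0 \<beta> k"
    by (intro agree_extend_code[OF assms(1)] agree_mono[OF k]) simp
  then have "agree \<bar>x\<bar> (extend_code s \<beta> \<alpha> (extend_code r \<alpha> \<beta> w)) 0 \<alpha> k"
    by (rule agree_extend_code[OF assms(2)])
  moreover have "agree \<bar>x\<bar> w 0 \<alpha> k" by (rule agree_mono[OF k]) simp
  ultimately show "extend_code s \<beta> \<alpha> (extend_code r \<alpha> \<beta> w) x = w x"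
    using agreeD[of "\<bar>x\<bar>" _ 0 \<alpha> k x] by (metis add_0 order_refl)
qed

lemma continuous_on_extend_code:
  assumes "local_code r \<alpha> \<beta>"
  shows "continuous_on (closure (orbit \<alpha>)) (extend_code r \<alpha> \<beta>)"
  unfolding continuous_on_def
proof
  fix w assume w: "w \<in> closure (orbit \<alpha>)"
  let ?F = "at w within closure (orbit \<alpha>)"
  have "((\<lambda>v. v) \<longlongrightarrow> w) ?F" by (rule tendsto_ident_at)
  then have ev: "\<forall>\<^sub>F v in ?F. agree (N + r) v 0 w 0" for N
    by (simp add: tendsto_iff_eventually_agree)
  have "\<forall>\<^sub>F v in ?F. agree N (extend_code r \<alpha> \<beta> v) 0 (extend_code r \<alpha> \<beta> w) 0" for N
    using ev[of N]
  proof eventually_elim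
    case (elim v)
    obtain k where k: "agree (N + r) w 0 \<alpha> k"
      using w unfolding closure_orbit_iff_agree by blast
    then show ?case
      using agree_extend_code[OF assms k] agree_extend_code[OF assms agree_trans[OF elim k]]
        agree_sym agree_trans by blast
  qed
  then show "(extend_code r \<alpha> \<beta> \<longlongrightarrow> extend_code r \<alpha> \<beta> w) ?F"
    by (simp add: tendsto_iff_eventually_agree)
qed

lemma extend_code_shift:
  assumes "local_code r \<alpha> \<beta>" "w \<in> closure (orbit \<alpha>)"
  shows "extend_code r \<alpha> \<beta> (shift w) = shift (extend_code r \<alpha> \<beta> w)"
proof
  fix x
  have "agree r (shift w) x \<alpha> k \<longleftrightarrow> agree r w (x + 1) \<alpha> k" for k
    by (simp add: agree_def shift_def add_ac)
  then show "extend_code r \<alpha> \<beta> (shift w) x = shift (extend_code r \<alpha> \<beta> w) x"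
    by (simp add: extend_code_def shift_def)
qed

lemma top_conjugate_of_local_codes:
  assumes "local_code r \<alpha> \<beta>" "local_code s \<beta> \<alpha>"
  shows "top_conjugate (closure (orbit \<alpha>)) (closure (orbit \<beta>))"
proof -
  have "homeomorphism (closure (orbit \<alpha>)) (closure (orbit \<beta>))
      (extend_code r \<alpha> \<beta>) (extend_code s \<beta> \<alpha>)"
    using assms by (intro homeomorphismI continuous_on_extend_code)
      (auto simp: extend_code_inverse intro: extend_code_mem)
  then show ?thesis
    unfolding top_conjugate_def using extend_code_shift[OF assms(1)] by blast
qed

section \<open>Skeletons of the points of a Toeplitz subshift\<close>

lemma Per_cong:
  assumes "i \<in> Per p \<alpha>" "int p dvd j - i"
  shows "\<alpha> j = \<alpha> i"
proof -
  obtain k where "j - i = int p * k" using assms(2) by (elim dvdE)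
  then have "j = i + int p * k" by simp
  then show ?thesis using assms(1) by (simp add: Per_def)
qed

lemma Per_mem_cong:
  assumes "int p dvd j - i"
  shows "i \<in> Per p \<alpha> \<longleftrightarrow> j \<in> Per p \<alpha>"
proof -
  have *: "j \<in> Per p \<alpha>" if "i \<in> Per p \<alpha>" "int p dvd j - i" for i j
  proof -
    have "\<alpha> (j + int p * k) = \<alpha> i" for k
      using dvd_add[OF that(2) dvd_triv_left[of "int p" k]]
      by (intro Per_cong[OF that(1)]) (simp add: algebra_simps)
    moreover have "\<alpha> j = \<alpha> i" using that by (rule Per_cong)
    ultimately show ?thesis by (simp add: Per_def)
  qed
  have "int p dvd i - j" using assms by (simp add: dvd_diff_commute)
  then show ?thesis using *[of i j] *[of j i] assms by blast
qed

lemma PerI: "(\<And>k. \<alpha> (i + int p * k) = \<alpha> i) \<Longrightarrow> i \<in> Per p \<alpha>"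
  by (simp add: Per_def)

lemma Per_dvd:
  assumes "p dvd q"
  shows "Per p \<alpha> \<subseteq> Per q \<alpha>"
proof
  fix i assume i: "i \<in> Per p \<alpha>"
  have "int p dvd (i + int q * k) - i" for k using assms by simp
  then have "\<alpha> (i + int q * k) = \<alpha> i" for k by (rule Per_cong[OF i])
  then show "i \<in> Per q \<alpha>" by (rule PerI)
qed

lemma skeleton_cong:
  assumes "int p dvd j - i"
  shows "skeleton p \<alpha> i = skeleton p \<alpha> j"
proof (cases "i \<in> Per p \<alpha>")
  case True
  then have "j \<in> Per p \<alpha>" "\<alpha> j = \<alpha> i"
    using Per_mem_cong[OF assms] Per_cong[OF True assms] by blast+
  then show ?thesis using True by (simp add: skeleton_def)
next
  case False
  then have "j \<notin> Per p \<alpha>" using Per_mem_cong[OF assms] by blast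
  then show ?thesis using False by (simp add: skeleton_def)
qed

lemma skeleton_eq_Some_iff: "skeleton p \<alpha> i = Some a \<longleftrightarrow> i \<in> Per p \<alpha> \<and> \<alpha> i = a"
  by (simp add: skeleton_def)

text \<open>\<open>Per\<close> grows along divisibility, so the periods of the single positions can
  be multiplied together, starting from \<open>M\<close>.\<close>

lemma common_period:
  assumes "(\<Union>p\<in>{0<..}. Per p \<alpha>) = UNIV" "finite X" "M > 0"
  shows "\<exists>L>0. M dvd L \<and> X \<subseteq> Per L \<alpha>"
  using assms(2)
proof (induction X rule: finite_induct)
  case empty
  show ?case by (rule exI[of _ M]) (simp add: assms(3))
next
  case (insert x X)
  then obtain L where L: "L > 0" "M dvd L" "X \<subseteq> Per L \<alpha>" by blast
  have "x \<in> (\<Union>p\<in>{0<..}. Per p \<alpha>)" by (simp add: assms(1))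
  then obtain p where p: "p > 0" "x \<in> Per p \<alpha>" by auto
  have "insert x X \<subseteq> Per (L * p) \<alpha>"
    using L(3) p(2) Per_dvd[of L "L * p" \<alpha>] Per_dvd[of p "L * p" \<alpha>] by auto
  then show ?case using L p by (intro exI[of _ "L * p"]) auto
qed

text \<open>A window of radius \<open>r\<close>, wherever it is centred, exposes every hole of the
  \<open>p\<close>-skeleton by showing two different letters in its residue class. The bound
  \<open>int p \<le> r\<close> makes the window meet every residue class.\<close>

definition detects :: "nat \<Rightarrow> int \<Rightarrow> (int \<Rightarrow> nat) \<Rightarrow> bool" where
  "detects p r \<alpha> \<longleftrightarrow> int p \<le> r \<and>
     (\<forall>k i. i \<notin> Per p \<alpha> \<longrightarrow> (\<exists>x y. \<bar>x\<bar> \<le> r \<and> \<bar>y\<bar> \<le> r \<and> int p dvd k + x - i \<and> int p dvd k + y - i \<and>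
        \<alpha> (k + x) \<noteq> \<alpha> (k + y)))"

text \<open>For each hole in \<open>{0..<int p}\<close> fix a second position of its class with
  another letter. These finitely many positions have a common period \<open>L\<close> divisible by
  \<open>p\<close>, so the witnesses recur within bounded distance of every
  \<open>k\<close>.\<close>

lemma toeplitz_detects:
  assumes "(\<Union>p\<in>{0<..}. Per p \<alpha>) = UNIV" "p > 0"
  shows "\<exists>r. detects p r \<alpha>"
proof -
  have "\<exists>k. i \<notin> Per p \<alpha> \<longrightarrow> \<alpha> (i + int p * k) \<noteq> \<alpha> i" for i
    by (auto simp: Per_def)
  then obtain m where m: "\<And>i. i \<notin> Per p \<alpha> \<Longrightarrow> \<alpha> (i + int p * m i) \<noteq> \<alpha> i" by metis
  define X where "X = {0..<int p} \<union> (\<lambda>i. i + int p * m i) ` {0..<int p}"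
  have "finite X" by (simp add: X_def)
  obtain L where L: "L > 0" "p dvd L" "X \<subseteq> Per L \<alpha>"
    using common_period[OF assms(1) \<open>finite X\<close> assms(2)] by blast
  define B where "B = Max (abs ` X)"
  have B: "\<bar>x\<bar> \<le> B" if "x \<in> X" for x
    using that \<open>finite X\<close> by (simp add: B_def)
  have "0 \<in> X" using assms(2) by (simp add: X_def)
  then have "0 \<le> B" using B by force
  have "\<exists>x y. \<bar>x\<bar> \<le> B + int L + int p \<and> \<bar>y\<bar> \<le> B + int L + int p \<and>
      int p dvd k + x - i \<and> int p dvd k + y - i \<and> \<alpha> (k + x) \<noteq> \<alpha> (k + y)"
    if i: "i \<notin> Per p \<alpha>" for k i
  proof -
    define j where "j = i mod int p"
    define c where "c = k - k mod int L"
    have Lc: "int L dvd c" by (simp add: c_def minus_mod_eq_mult_div)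
    then have pc: "int p dvd c" using L(2) by (meson dvd_trans of_nat_dvd_iff)
    have pj: "int p dvd j - i" using dvd_minus_mod[of "int p" i] by (simp add: j_def dvd_diff_commute)
    have "j \<notin> Per p \<alpha>" using i Per_mem_cong[OF pj] by blast
    then have neq: "\<alpha> (j + int p * m j) \<noteq> \<alpha> j" by (rule m)
    have ck: "\<bar>c - k\<bar> \<le> int L" using L(1) by (simp add: c_def less_imp_le)
    have "j \<in> {0..<int p}" using assms(2) by (simp add: j_def)
    then have X: "j \<in> X" "j + int p * m j \<in> X" by (auto simp: X_def)
    have "\<alpha> (j + c) = \<alpha> j" "\<alpha> (j + int p * m j + c) = \<alpha> (j + int p * m j)"
      using X L(3) Lc by (auto intro!: Per_cong[of _ L])
    moreover have "\<bar>j + (c - k)\<bar> \<le> B + int L + int p" "\<bar>j + int p * m j + (c - k)\<bar> \<le> B + int L + int p"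
      using B[OF X(1)] B[OF X(2)] ck by linarith+
    moreover have "int p dvd j + c - i" "int p dvd j + int p * m j + c - i"
    proof -
      show "int p dvd j + c - i" using dvd_add[OF pj pc] by (simp add: algebra_simps)
      from dvd_add[OF this dvd_triv_left[of "int p" "m j"]]
      show "int p dvd j + int p * m j + c - i" by (simp add: algebra_simps)
    qed
    ultimately show ?thesis using neq
      by (intro exI[of _ "j + (c - k)"] exI[of _ "j + int p * m j + (c - k)"]) (simp add: algebra_simps)
  qed
  then have "detects p (B + int L + int p) \<alpha>" using \<open>0 \<le> B\<close> by (simp add: detects_def)
  then show ?thesis ..
qed

lemma self_mem_closure_orbit: "\<alpha> \<in> closure (orbit \<alpha>)"
  unfolding closure_orbit_iff_agree by (intro allI exI[of _ 0]) (simp add: agree_def)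

lemma residue_near:
  assumes "p > 0"
  shows "\<exists>x. \<bar>x\<bar> \<le> int p \<and> int p dvd x - i"
proof -
  have "0 \<le> i mod int p" "i mod int p < int p" using assms by simp_all
  then have "\<bar>i mod int p\<bar> \<le> int p" by linarith
  moreover have "int p dvd i mod int p - i" using dvd_minus_mod[of "int p" i] by (simp add: dvd_diff_commute)
  ultimately show ?thesis by blast
qed

text \<open>On a class filled relative to \<open>k\<close> the window shows one letter only. The
  equal window at \<open>l\<close> then shows no hole in that class, and since it meets the class,
  it also fixes the letter.\<close>

lemma detects_Per:
  assumes det: "detects p r \<alpha>" and "p > 0" "agree r \<alpha> k \<alpha> l" "i + k \<in> Per p \<alpha>"
  shows "i + l \<in> Per p \<alpha> \<and> \<alpha> (i + l) = \<alpha> (i + k)"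
proof
  have *: "\<alpha> (l + x) = \<alpha> (i + k)" if "\<bar>x\<bar> \<le> r" "int p dvd x - i" for x
  proof -
    have "\<alpha> (k + x) = \<alpha> (i + k)" using that(2) by (intro Per_cong[OF assms(4)]) (simp add: algebra_simps)
    then show ?thesis using agreeD[OF assms(3) that(1)] by simp
  qed
  show per: "i + l \<in> Per p \<alpha>"
  proof (rule ccontr)
    assume "i + l \<notin> Per p \<alpha>"
    then obtain x y where xy: "\<bar>x\<bar> \<le> r" "\<bar>y\<bar> \<le> r" "int p dvd l + x - (i + l)" "int p dvd l + y - (i + l)"
        "\<alpha> (l + x) \<noteq> \<alpha> (l + y)"
      using det unfolding detects_def by blast
    then show False using *[of x] *[of y] by simp
  qed
  obtain x where x: "\<bar>x\<bar> \<le> int p" "int p dvd x - i" using residue_near[OF \<open>p > 0\<close>] by blast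
  then have "\<bar>x\<bar> \<le> r" using det by (auto simp: detects_def)
  from *[OF this x(2)] have "\<alpha> (l + x) = \<alpha> (i + k)" .
  moreover have "\<alpha> (l + x) = \<alpha> (i + l)" using x(2) by (intro Per_cong[OF per]) (simp add: algebra_simps)
  ultimately show "\<alpha> (i + l) = \<alpha> (i + k)" by simp
qed

lemma detects_skeleton:
  assumes "detects p r \<alpha>" "p > 0" "agree r \<alpha> k \<alpha> l"
  shows "skeleton p \<alpha> (i + k) = skeleton p \<alpha> (i + l)"
proof (cases "i + k \<in> Per p \<alpha>")
  case True
  then show ?thesis using detects_Per[OF assms True] by (simp add: skeleton_def)
next
  case False
  then have "i + l \<notin> Per p \<alpha>"
    using detects_Per[OF assms(1,2) agree_sym[OF assms(3)], of i] by blast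
  then show ?thesis using False by (simp add: skeleton_def)
qed

text \<open>Points of one Toeplitz subshift need not be translates of each other, but after a
  translation they can share any given window together with the whole \<open>p\<close>-skeleton.
  Finite and \<open>p\<close>-periodic data are moved between points by this relation.\<close>

definition similar :: "nat \<Rightarrow> int \<Rightarrow> (int \<Rightarrow> nat) \<Rightarrow> (int \<Rightarrow> nat) \<Rightarrow> int \<Rightarrow> bool" where
  "similar p r \<gamma> \<delta> k \<longleftrightarrow> agree r \<gamma> 0 \<delta> k \<and> (\<forall>i. skeleton p \<gamma> i = skeleton p \<delta> (i + k))"

lemma similar_trans:
  assumes "similar p (r + \<bar>l\<bar>) \<beta> \<gamma> k" "similar p r \<alpha> \<beta> l"
  shows "similar p r \<alpha> \<gamma> (k + l)"
proof -
  have "agree r \<beta> (0 + l) \<gamma> (k + l)"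
    using assms(1) by (intro agree_translate[of "r + \<bar>l\<bar>"]) (auto simp: similar_def)
  then show ?thesis using assms agree_trans by (fastforce simp: similar_def add_ac)
qed

text \<open>For \<open>q dvd M\<close> the set \<open>Per q\<close> can be read off the
  \<open>M\<close>-skeleton: its members are the positions along whose class modulo \<open>q\<close>
  that skeleton is filled and constant.\<close>

lemma similar_Per_iff:
  assumes "similar M r \<gamma> \<delta> k" "q dvd M"
  shows "i \<in> Per q \<gamma> \<longleftrightarrow> i + k \<in> Per q \<delta>"
proof -
  have char: "i \<in> Per q \<beta> \<longleftrightarrow> (\<exists>a. \<forall>m. skeleton M \<beta> (i + int q * m) = Some a)" for \<beta> i
  proof
    assume i: "i \<in> Per q \<beta>"
    have "i + int q * m \<in> Per q \<beta>" for m using i Per_mem_cong[of q "i + int q * m" i \<beta>] by simp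
    then have "i + int q * m \<in> Per M \<beta>" for m using Per_dvd[OF assms(2)] by blast
    then have "skeleton M \<beta> (i + int q * m) = Some (\<beta> i)" for m
      using Per_cong[OF i, of "i + int q * m"] by (simp add: skeleton_def)
    then show "\<exists>a. \<forall>m. skeleton M \<beta> (i + int q * m) = Some a" by blast
  next
    assume "\<exists>a. \<forall>m. skeleton M \<beta> (i + int q * m) = Some a"
    then obtain a where a: "\<And>m. \<beta> (i + int q * m) = a" by (auto simp: skeleton_eq_Some_iff)
    then show "i \<in> Per q \<beta>" using a[of 0] by (intro PerI) simp
  qed
  have "skeleton M \<gamma> (i + int q * m) = skeleton M \<delta> (i + k + int q * m)" for m
    using assms(1) by (simp add: similar_def add_ac)
  then show ?thesis unfolding char by simp
qed

lemma similar_toeplitz: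
  assumes \<alpha>: "(\<Union>p\<in>{0<..}. Per p \<alpha>) = UNIV" and \<gamma>: "\<gamma> \<in> closure (orbit \<alpha>)" and "p > 0"
  shows "\<exists>k. similar p r \<gamma> \<alpha> k"
proof -
  obtain s where s: "detects p s \<alpha>" using toeplitz_detects[OF \<alpha> \<open>p > 0\<close>] by blast
  obtain k where k: "agree (max r s) \<gamma> 0 \<alpha> k" using \<gamma> by (auto simp: closure_orbit_iff_agree)
  \<comment> \<open>Larger windows of \<gamma> occur in \<alpha> at other places \<open>k'\<close>,
    but these share a detecting window with \<open>k\<close>, so the skeleton seen from
    \<open>k'\<close> is the one seen from \<open>k\<close>.\<close>
  have k': "\<exists>k'. agree R \<gamma> 0 \<alpha> k' \<and> (\<forall>i. skeleton p \<alpha> (i + k') = skeleton p \<alpha> (i + k))" for R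
  proof -
    obtain k' where k': "agree (max R s) \<gamma> 0 \<alpha> k'" using \<gamma> by (auto simp: closure_orbit_iff_agree)
    have "agree s \<alpha> k' \<alpha> k"
      by (intro agree_trans[OF agree_sym[OF agree_mono[OF k']] agree_mono[OF k]]) auto
    then show ?thesis using detects_skeleton[OF s \<open>p > 0\<close>] agree_mono[OF k', of R] by auto
  qed
  have "skeleton p \<gamma> i = skeleton p \<alpha> (i + k)" for i
  proof (cases "i + k \<in> Per p \<alpha>")
    case True
    have *: "\<gamma> j = \<alpha> (i + k)" if j: "int p dvd j - i" for j
    proof -
      obtain k' where k': "agree \<bar>j\<bar> \<gamma> 0 \<alpha> k'" "skeleton p \<alpha> (j + k') = skeleton p \<alpha> (j + k)"
        using k'[of "\<bar>j\<bar>"] by blast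
      have "skeleton p \<alpha> (j + k) = skeleton p \<alpha> (i + k)"
        using j by (intro skeleton_cong) (simp add: dvd_diff_commute)
      then have "\<alpha> (j + k') = \<alpha> (i + k)"
        using True k'(2) by (metis skeleton_eq_Some_iff)
      then show ?thesis using agreeD[OF k'(1), of j] by (simp add: add.commute)
    qed
    then have "i \<in> Per p \<gamma>" by (intro PerI) simp
    then show ?thesis using True *[of i] by (simp add: skeleton_def)
  next
    case False
    then obtain x y where xy: "\<bar>x\<bar> \<le> s" "\<bar>y\<bar> \<le> s" "int p dvd k + x - (i + k)" "int p dvd k + y - (i + k)"
        "\<alpha> (k + x) \<noteq> \<alpha> (k + y)"
      using s unfolding detects_def by blast
    have "\<gamma> x \<noteq> \<gamma> y" using agreeD[OF k, of x] agreeD[OF k, of y] xy by simp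
    then have "i \<notin> Per p \<gamma>" using xy(3,4) Per_cong[of i p \<gamma> x] Per_cong[of i p \<gamma> y] by auto
    with False show ?thesis by (simp add: skeleton_def)
  qed
  then have "similar p r \<gamma> \<alpha> k" using agree_mono[OF k, of r] by (auto simp: similar_def)
  then show ?thesis ..
qed

text \<open>Translating back by \<open>- k\<close> could leave the window on which \<gamma> and
  \<alpha> are known to agree. As the window of \<alpha> at 0 has period \<open>L\<close>, a
  multiple of \<open>p\<close>, a small \<open>l\<close> congruent to \<open>- k\<close> modulo
  \<open>L\<close> serves instead.\<close>

lemma similar_toeplitz_converse:
  assumes \<alpha>: "(\<Union>p\<in>{0<..}. Per p \<alpha>) = UNIV" and \<gamma>: "\<gamma> \<in> closure (orbit \<alpha>)" and "p > 0"
  shows "\<exists>k. similar p r \<alpha> \<gamma> k"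
proof -
  obtain L where L: "L > 0" "p dvd L" "{-r..r} \<subseteq> Per L \<alpha>"
    using common_period[of \<alpha> "{-r..r}" p, OF \<alpha> _ \<open>p > 0\<close>] by auto
  obtain k where k: "similar p (r + int L) \<gamma> \<alpha> k"
    using similar_toeplitz[OF assms] by blast
  obtain l where l: "\<bar>l\<bar> \<le> int L" "int L dvd l - (- k)" using residue_near[OF L(1)] by blast
  have "agree r \<gamma> (0 + l) \<alpha> (k + l)"
    using k l(1) by (intro agree_translate[of "r + int L"]) (auto simp: similar_def)
  moreover have "\<alpha> (k + l + j) = \<alpha> j" if "\<bar>j\<bar> \<le> r" for j
    using L(3) that l(2) by (intro Per_cong[of j L]) (auto simp: abs_le_iff add.commute)
  ultimately have "agree r \<alpha> 0 \<gamma> l" by (simp add: agree_def)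
  moreover have "skeleton p \<alpha> i = skeleton p \<gamma> (i + l)" for i
  proof -
    have "int p dvd l + k" using l(2) L(2) by (metis diff_minus_eq_add dvd_trans of_nat_dvd_iff)
    then have "skeleton p \<alpha> i = skeleton p \<alpha> (i + l + k)"
      by (intro skeleton_cong) (simp add: algebra_simps)
    then show ?thesis using k by (simp add: similar_def)
  qed
  ultimately show ?thesis by (auto simp: similar_def)
qed

lemma toeplitz_subshift_similar:
  assumes "toeplitz_subshift n S" "\<gamma> \<in> S" "\<delta> \<in> S" "p > 0"
  shows "\<exists>k. similar p r \<gamma> \<delta> k"
proof -
  obtain \<alpha> where \<alpha>: "(\<Union>p\<in>{0<..}. Per p \<alpha>) = UNIV" and S: "S = closure (orbit \<alpha>)"
    using assms(1) by (auto simp: toeplitz_subshift_def toeplitz_seq_def)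
  obtain l where l: "similar p r \<gamma> \<alpha> l"
    using similar_toeplitz[OF \<alpha>] assms(2,4) S by blast
  obtain k where "similar p (r + \<bar>l\<bar>) \<alpha> \<delta> k"
    using similar_toeplitz_converse[OF \<alpha>] assms(3,4) S by blast
  from similar_trans[OF this l] show ?thesis ..
qed

text \<open>Minimality of Toeplitz subshifts: every window of any point of \<open>S\<close> occurs
  in \<gamma>.\<close>

lemma toeplitz_subshift_eq_closure:
  assumes S: "toeplitz_subshift n S" and \<gamma>: "\<gamma> \<in> S"
  shows "S = closure (orbit \<gamma>)"
proof
  have "\<exists>k. agree r \<delta> 0 \<gamma> k" if "\<delta> \<in> S" for \<delta> r
    using toeplitz_subshift_similar[OF S that \<gamma>, of 1 r] by (auto simp: similar_def)
  then show "S \<subseteq> closure (orbit \<gamma>)" by (auto simp: closure_orbit_iff_agree)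
  have "orbit \<gamma> \<subseteq> S" "closed S"
    using S \<gamma> translate_mem_closure_orbit by (auto simp: toeplitz_subshift_def orbit_def)
  then show "closure (orbit \<gamma>) \<subseteq> S" by (rule closure_minimal)
qed

section \<open>Recognizable periods and the scale\<close>

text \<open>Position modulo \<open>q\<close> is a function of a window. Unlike essential periods,
  this notion visibly passes through block codes, so it serves to show that the scale is a conjugacy
  invariant.\<close>

definition recognizes :: "(int \<Rightarrow> nat) \<Rightarrow> nat \<Rightarrow> bool" where
  "recognizes \<gamma> q \<longleftrightarrow> (\<exists>r. \<forall>k l. agree r \<gamma> k \<gamma> l \<longrightarrow> int q dvd k - l)"

text \<open>The windows of \<delta> at \<open>k\<close> and \<open>l\<close> lie in one larger
  window, which occurs in \<gamma> with the difference \<open>k - l\<close> unchanged.\<close>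

lemma recognizes_transfer:
  assumes "toeplitz_subshift n S" "\<gamma> \<in> S" "\<delta> \<in> S" "recognizes \<gamma> q"
  shows "recognizes \<delta> q"
proof -
  obtain r where r: "\<And>k l. agree r \<gamma> k \<gamma> l \<Longrightarrow> int q dvd k - l"
    using assms(4) by (auto simp: recognizes_def)
  have "int q dvd k - l" if kl: "agree r \<delta> k \<delta> l" for k l
  proof -
    obtain c where c: "similar 1 (r + \<bar>k\<bar> + \<bar>l\<bar>) \<delta> \<gamma> c"
      using toeplitz_subshift_similar[OF assms(1,3,2)] by (metis zero_less_one)
    then have c': "agree (r + \<bar>k\<bar> + \<bar>l\<bar>) \<delta> 0 \<gamma> c" by (simp add: similar_def)
    have "agree r \<delta> (0 + k) \<gamma> (c + k)" "agree r \<delta> (0 + l) \<gamma> (c + l)"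
      by (rule agree_translate[OF c'], simp)+
    then have "agree r \<gamma> (c + k) \<gamma> (c + l)" using kl agree_sym agree_trans by (metis add_0)
    from r[OF this] show ?thesis by simp
  qed
  then show ?thesis by (auto simp: recognizes_def)
qed

lemma essential_period_transfer:
  assumes "toeplitz_subshift n S" "\<gamma> \<in> S" "\<delta> \<in> S" "essential_period \<gamma> p"
  shows "essential_period \<delta> p"
proof -
  \<comment> \<open>\<open>fact p\<close> is a multiple of every \<open>q \<le> p\<close>, so one
    translation handles all the sets \<open>Per q\<close> that the definition compares.\<close>
  obtain k where k: "similar (fact p) 0 \<gamma> \<delta> k"
    using toeplitz_subshift_similar[OF assms(1-3)] by (metis fact_gt_zero)
  have p: "p > 0" using assms(4) by (simp add: essential_period_def)
  have Per: "Per q \<gamma> = (\<lambda>i. i - k) ` Per q \<delta>" if "0 < q" "q \<le> p" for q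
  proof -
    have "q dvd fact p" using that by (simp add: dvd_fact)
    then show ?thesis using similar_Per_iff[OF k] by (force simp: image_iff)
  qed
  have inj: "(\<lambda>i. i - k) ` A = (\<lambda>i. i - k) ` B \<longleftrightarrow> A = B" for A B
    by (rule inj_image_eq_iff) (simp add: inj_def)
  show ?thesis
    using assms(4) p by (auto simp: essential_period_def Per inj less_imp_le)
qed

lemma ex_essential_period:
  assumes "M > 0" "Per M \<alpha> \<noteq> {}"
  shows "\<exists>p. essential_period \<alpha> p \<and> Per p \<alpha> = Per M \<alpha>"
proof -
  define p where "p = (LEAST p. p > 0 \<and> Per p \<alpha> = Per M \<alpha>)"
  have p: "p > 0 \<and> Per p \<alpha> = Per M \<alpha>" unfolding p_def by (rule LeastI) (use assms in auto)
  have "\<not> (q > 0 \<and> Per q \<alpha> = Per M \<alpha>)" if "q < p" for q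
    using that not_less_Least unfolding p_def by blast
  then have "essential_period \<alpha> p" using p assms(2) unfolding essential_period_def by metis
  then show ?thesis using p by blast
qed

text \<open>Equal detecting windows make \<open>d = k - l\<close> a symmetry of the
  \<open>p\<close>-skeleton. By Bezout so is \<open>g = gcd d p\<close>, whence \<open>Per p\<close>
  and \<open>Per g\<close> coincide, and minimality of the essential period forces
  \<open>g = p\<close>.\<close>

lemma recognizes_essential:
  assumes \<alpha>: "(\<Union>p\<in>{0<..}. Per p \<alpha>) = UNIV" and p: "essential_period \<alpha> p"
  shows "recognizes \<alpha> p"
proof -
  have "p > 0" using p by (simp add: essential_period_def)
  obtain r where r: "detects p r \<alpha>" using toeplitz_detects[OF \<alpha> \<open>p > 0\<close>] by blast
  have "int p dvd k - l" if kl: "agree r \<alpha> k \<alpha> l" for k l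
  proof -
    define d where "d = k - l"
    have step: "skeleton p \<alpha> (i + d) = skeleton p \<alpha> i" for i
      using detects_skeleton[OF r \<open>p > 0\<close> kl, of "i - l"] by (simp add: d_def algebra_simps)
    have nat_mult: "skeleton p \<alpha> (i + d * int m) = skeleton p \<alpha> i" for i m
    proof (induction m)
      case (Suc m)
      then show ?case using step[of "i + d * int m"] by (simp add: algebra_simps)
    qed simp
    have mult: "skeleton p \<alpha> (i + d * m) = skeleton p \<alpha> i" for i m
    proof (cases "m \<ge> 0")
      case True
      then show ?thesis using nat_mult[of i "nat m"] by simp
    next
      case False
      then show ?thesis using nat_mult[of "i + d * m" "nat (- m)"] by (simp add: algebra_simps)
    qed
    define g where "g = nat (gcd d (int p))"
    have g: "g > 0" "int g = gcd d (int p)" using \<open>p > 0\<close> by (simp_all add: g_def)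
    have "g dvd p" using g(2) by (metis gcd_dvd2 of_nat_dvd_iff)
    obtain u v where uv: "u * d + v * int p = int g" using bezout_int[of d "int p"] g(2) by auto
    have "Per p \<alpha> \<subseteq> Per g \<alpha>"
    proof
      fix i assume i: "i \<in> Per p \<alpha>"
      have "skeleton p \<alpha> (i + int g * m) = skeleton p \<alpha> i" for m
      proof -
        have "skeleton p \<alpha> (i + int g * m) = skeleton p \<alpha> (i + d * (u * m))"
          by (intro skeleton_cong) (simp add: uv[symmetric] algebra_simps)
        then show ?thesis using mult by simp
      qed
      then show "i \<in> Per g \<alpha>" using i by (intro PerI) (metis skeleton_eq_Some_iff)
    qed
    then have "Per p \<alpha> = Per g \<alpha>" using Per_dvd[OF \<open>g dvd p\<close>] by blast
    then have "\<not> g < p" using p g(1) by (auto simp: essential_period_def)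
    then have "g = p" using dvd_imp_le[OF \<open>g dvd p\<close> \<open>p > 0\<close>] by simp
    then show ?thesis using g(2) unfolding d_def by (metis gcd_dvd1)
  qed
  then show ?thesis by (auto simp: recognizes_def)
qed

lemma recognizes_dvd: "recognizes \<gamma> p \<Longrightarrow> q dvd p \<Longrightarrow> recognizes \<gamma> q"
  unfolding recognizes_def by (meson dvd_trans of_nat_dvd_iff)

lemma recognizes_mult:
  assumes "recognizes \<gamma> p" "recognizes \<gamma> q" "coprime p q"
  shows "recognizes \<gamma> (p * q)"
proof -
  obtain r s where rs: "\<And>k l. agree r \<gamma> k \<gamma> l \<Longrightarrow> int p dvd k - l"
     "\<And>k l. agree s \<gamma> k \<gamma> l \<Longrightarrow> int q dvd k - l"
    using assms(1,2) by (auto simp: recognizes_def)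
  have "int (p * q) dvd k - l" if "agree (max r s) \<gamma> k \<gamma> l" for k l
    using rs[of k l] agree_mono[OF that] assms(3) by (auto intro: divides_mult)
  then show ?thesis by (auto simp: recognizes_def)
qed

text \<open>Conversely to \<open>recognizes_essential\<close>, an essential period \<open>p\<close>
  whose skeleton fills a recognizing window repeats that window at distance \<open>p\<close>, so
  \<open>q\<close> divides \<open>p\<close>.\<close>

lemma recognizes_iff_essential:
  assumes S: "toeplitz_subshift n S" and \<gamma>: "\<gamma> \<in> S"
  shows "recognizes \<gamma> q \<longleftrightarrow> (\<exists>p. essential_period \<gamma> p \<and> q dvd p)"
proof -
  obtain \<alpha> where \<alpha>: "(\<Union>p\<in>{0<..}. Per p \<alpha>) = UNIV" and "S = closure (orbit \<alpha>)"
    using S by (auto simp: toeplitz_subshift_def toeplitz_seq_def)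
  then have "\<alpha> \<in> S" using self_mem_closure_orbit by blast
  have "\<exists>p. essential_period \<alpha> p \<and> q dvd p" if rec: "recognizes \<alpha> q"
  proof -
    obtain r where r: "\<And>k l. agree r \<alpha> k \<alpha> l \<Longrightarrow> int q dvd k - l"
      using rec by (auto simp: recognizes_def)
    \<comment> \<open>\<open>max 0 r\<close> keeps 0 in the interval, so that \<open>Per M\<close>
      is nonempty and is also the set of an essential period.\<close>
    obtain M where M: "M > 0" "{- max 0 r..max 0 r} \<subseteq> Per M \<alpha>"
      using common_period[of \<alpha> "{- max 0 r..max 0 r}" 1, OF \<alpha>] by auto
    have "0 \<in> Per M \<alpha>" by (rule subsetD[OF M(2)]) simp
    then obtain p where p: "essential_period \<alpha> p" "Per p \<alpha> = Per M \<alpha>"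
      using ex_essential_period[OF M(1)] by blast
    have "\<alpha> (int p + j) = \<alpha> (0 + j)" if "\<bar>j\<bar> \<le> r" for j
    proof -
      have "j \<in> Per p \<alpha>" unfolding p(2) using that by (intro subsetD[OF M(2)]) auto
      then show ?thesis by (auto intro!: Per_cong)
    qed
    then have "agree r \<alpha> (int p) \<alpha> 0" unfolding agree_def by blast
    from r[OF this] p(1) show ?thesis by auto
  qed
  moreover have "recognizes \<alpha> q" if "essential_period \<alpha> p" "q dvd p" for p
    using recognizes_dvd[OF recognizes_essential[OF \<alpha> that(1)] that(2)] .
  moreover have "recognizes \<gamma> q \<longleftrightarrow> recognizes \<alpha> q"
    using recognizes_transfer[OF S] \<gamma> \<open>\<alpha> \<in> S\<close> by blast
  moreover have "essential_period \<gamma> p \<longleftrightarrow> essential_period \<alpha> p" for p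
    using essential_period_transfer[OF S] \<gamma> \<open>\<alpha> \<in> S\<close> by blast
  ultimately show ?thesis by blast
qed

lemma recognizes_local_code:
  assumes "local_code r \<alpha> \<beta>" "recognizes \<beta> q"
  shows "recognizes \<alpha> q"
proof -
  obtain s where s: "\<And>k l. agree s \<beta> k \<beta> l \<Longrightarrow> int q dvd k - l"
    using assms(2) by (auto simp: recognizes_def)
  have "agree s \<beta> k \<beta> l" if kl: "agree (r + s) \<alpha> k \<alpha> l" for k l
    unfolding agree_def
  proof (intro allI impI)
    fix j :: int assume "\<bar>j\<bar> \<le> s"
    then have "agree r \<alpha> (k + j) \<alpha> (l + j)" by (intro agree_translate[OF kl]) simp
    then show "\<beta> (k + j) = \<beta> (l + j)" using assms(1) by (simp add: local_code_def)
  qed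
  then show ?thesis unfolding recognizes_def using s by blast
qed

section \<open>The scale and its factorization in terms of recognizable periods\<close>

lemma prime_nth_prime: "prime (nth_prime i)"
  using enumerate_in_set[OF primes_infinite, of i] by (simp add: nth_prime_def)

lemma nth_prime_eq_iff: "nth_prime i = nth_prime j \<longleftrightarrow> i = j"
  using strict_mono_enumerate[OF primes_infinite] by (simp add: nth_prime_def strict_mono_eq)

lemma ex_nth_prime:
  assumes "prime p"
  shows "\<exists>i\<le>p. nth_prime i = p"
proof -
  obtain i where i: "nth_prime i = p"
    using enumerate_Ex[of "{p. prime p}" p] assms primes_infinite by (auto simp: nth_prime_def)
  then have "i \<le> p" using le_enumerate[OF primes_infinite, of i] by (simp add: nth_prime_def)
  then show ?thesis using i by blast
qed

lemma scale_eq_recognizes: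
  assumes "toeplitz_subshift n S" "\<gamma> \<in> S"
  shows "scale S i = (SUP j\<in>{j. recognizes \<gamma> (nth_prime i ^ j)}. enat j)"
proof -
  have "(\<exists>\<alpha>\<in>S. \<exists>p. essential_period \<alpha> p \<and> q dvd p) \<longleftrightarrow> recognizes \<gamma> q" for q
  proof
    assume "\<exists>\<alpha>\<in>S. \<exists>p. essential_period \<alpha> p \<and> q dvd p"
    then obtain \<alpha> where "\<alpha> \<in> S" "recognizes \<alpha> q"
      using recognizes_iff_essential[OF assms(1)] by blast
    then show "recognizes \<gamma> q" using recognizes_transfer[OF assms(1) _ assms(2)] by blast
  next
    assume "recognizes \<gamma> q"
    then show "\<exists>\<alpha>\<in>S. \<exists>p. essential_period \<alpha> p \<and> q dvd p"
      using recognizes_iff_essential[OF assms] assms(2) by blast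
  qed
  then show ?thesis by (simp add: scale_def)
qed

lemma enat_le_scale_iff:
  assumes "toeplitz_subshift n S" "\<gamma> \<in> S"
  shows "enat j \<le> scale S i \<longleftrightarrow> recognizes \<gamma> (nth_prime i ^ j)"
proof
  assume "recognizes \<gamma> (nth_prime i ^ j)"
  then show "enat j \<le> scale S i"
    unfolding scale_eq_recognizes[OF assms] by (intro SUP_upper) simp
next
  assume le: "enat j \<le> scale S i"
  show "recognizes \<gamma> (nth_prime i ^ j)"
  proof (cases j)
    case 0
    then show ?thesis by (simp add: recognizes_def)
  next
    case (Suc j')
    \<comment> \<open>The supremum may be infinite and not attained, so the strict bound
      \<open>j'\<close> is used: some exponent above \<open>j'\<close> is recognized, and
      \<open>j\<close> is at most that exponent.\<close>
    then have "enat j' < scale S i" using le by (meson enat_ord_simps(2) lessI less_le_trans)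
    then obtain m where m: "recognizes \<gamma> (nth_prime i ^ m)" "j' < m"
      unfolding scale_eq_recognizes[OF assms] less_SUP_iff by auto
    then show ?thesis using Suc by (intro recognizes_dvd[OF m(1)] le_imp_power_dvd) simp
  qed
qed

lemma enat_exponent: "enat (the_enat (min k (enat m))) = min k (enat m)"
  by (cases k) (auto simp: min_def)

text \<open>Each truncated exponent is bounded by the scale, hence its prime power is recognized,
  and powers of distinct primes are coprime.\<close>

lemma recognizes_pre_factorization:
  assumes "toeplitz_subshift n S" "\<gamma> \<in> S"
  shows "recognizes \<gamma> (pre_factorization (scale S) t)"
proof -
  define e where "e i = the_enat (min (scale S i) (enat (t + 1)))" for i
  have e: "recognizes \<gamma> (nth_prime i ^ e i)" for i
    unfolding enat_le_scale_iff[OF assms, symmetric] e_def enat_exponent by simp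
  have "recognizes \<gamma> (\<Prod>i\<in>I. nth_prime i ^ e i)" if "finite I" for I
    using that
  proof (induction I rule: finite_induct)
    case empty
    then show ?case by (simp add: recognizes_def)
  next
    case (insert j I)
    have "coprime (nth_prime j ^ e j) (\<Prod>i\<in>I. nth_prime i ^ e i)"
    proof (intro prod_coprime_right)
      fix i assume "i \<in> I"
      then have "i \<noteq> j" using insert by blast
      then show "coprime (nth_prime j ^ e j) (nth_prime i ^ e i)"
        using primes_coprime[OF prime_nth_prime prime_nth_prime, of j i]
        by (simp add: nth_prime_eq_iff)
    qed
    then show ?case using insert e by (simp add: recognizes_mult)
  qed
  then show ?thesis by (simp add: pre_factorization_def e_def)
qed

lemma pre_factorization_pos: "pre_factorization k t > 0"
  unfolding pre_factorization_def using prime_gt_0_nat[OF prime_nth_prime] by (simp add: prod_pos)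

lemma pre_factorization_dvd:
  assumes "s \<le> t"
  shows "pre_factorization k s dvd pre_factorization k t"
proof -
  have "the_enat (min x (enat (s + 1))) \<le> the_enat (min x (enat (t + 1)))" for x
    using assms by (cases x) (auto simp: min_def)
  then have "(\<Prod>i\<le>s. nth_prime i ^ the_enat (min (k i) (enat (s + 1))))
      dvd (\<Prod>i\<le>s. nth_prime i ^ the_enat (min (k i) (enat (t + 1))))"
    by (intro prod_dvd_prod le_imp_power_dvd)
  also have "\<dots> dvd (\<Prod>i\<le>t. nth_prime i ^ the_enat (min (k i) (enat (t + 1))))"
    using assms by (intro prod_dvd_prod_subset) auto
  finally show ?thesis by (simp add: pre_factorization_def)
qed

text \<open>The term at index \<open>p\<close> is late enough: if \<open>r ^ m\<close> divides
  \<open>p\<close> with \<open>m > 0\<close>, the index of \<open>r\<close> is at most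
  \<open>r \<le> p\<close>, and \<open>m < 2 ^ m \<le> r ^ m \<le> p\<close>, so neither truncation
  cuts off this power.\<close>

lemma essential_period_dvd_pre_factorization:
  assumes "toeplitz_subshift n S" "\<gamma> \<in> S" "essential_period \<gamma> p"
  shows "p dvd pre_factorization (scale S) p"
proof -
  have p: "p > 0" using assms(3) by (simp add: essential_period_def)
  have "multiplicity r p \<le> multiplicity r (pre_factorization (scale S) p)" if r: "prime r" for r
  proof (cases "multiplicity r p = 0")
    case False
    define m where "m = multiplicity r p"
    have m: "r ^ m dvd p" by (simp add: m_def multiplicity_dvd)
    obtain i where i: "i \<le> r" "nth_prime i = r" using ex_nth_prime[OF r] by blast
    have rm: "r ^ m \<le> p" using m p by (rule dvd_imp_le)
    have "r ^ 1 \<le> r ^ m" using False prime_gt_0_nat[OF r] by (intro power_increasing) (auto simp: m_def)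
    then have "i \<le> p" using i(1) rm by simp
    have "m < 2 ^ m" by (rule less_exp)
    also have "\<dots> \<le> r ^ m" using prime_ge_2_nat[OF r] by (intro power_mono) auto
    finally have "m \<le> p" using rm by simp
    have "recognizes \<gamma> (nth_prime i ^ m)"
      using recognizes_iff_essential[OF assms(1,2)] assms(3) m i(2) by blast
    then have "enat m \<le> min (scale S i) (enat (p + 1))"
      using enat_le_scale_iff[OF assms(1,2), of m i] \<open>m \<le> p\<close> by simp
    then have "enat m \<le> enat (the_enat (min (scale S i) (enat (p + 1))))"
      by (simp only: enat_exponent)
    then have "m \<le> the_enat (min (scale S i) (enat (p + 1)))" by simp
    then have "r ^ m dvd nth_prime i ^ the_enat (min (scale S i) (enat (p + 1)))"
      using i(2) by (simp add: le_imp_power_dvd)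
    also have "\<dots> dvd pre_factorization (scale S) p"
      unfolding pre_factorization_def using \<open>i \<le> p\<close>
      by (intro dvd_prodI[of "{..p}" i "\<lambda>i. nth_prime i ^ the_enat (min (scale S i) (enat (p + 1)))"]) auto
    finally show ?thesis
      unfolding m_def[symmetric] using prime_gt_1_nat[OF r] pre_factorization_pos[of "scale S" p]
      by (intro multiplicity_geI) auto
  qed simp
  then show ?thesis using p by (intro multiplicity_le_imp_dvd) auto
qed

text \<open>Otherwise the generating Toeplitz sequence, whose \<open>p\<close>-skeleton is a
  translate of that of \<gamma>, would be periodic.\<close>

lemma Per_ne_UNIV:
  assumes S: "toeplitz_subshift n S" and "\<gamma> \<in> S" "p > 0"
  shows "Per p \<gamma> \<noteq> UNIV"
proof
  assume P: "Per p \<gamma> = UNIV"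
  obtain \<alpha> where \<alpha>: "\<not> periodic_seq \<alpha>" "S = closure (orbit \<alpha>)"
    using S by (auto simp: toeplitz_subshift_def toeplitz_seq_def)
  obtain k where k: "similar p 0 \<alpha> \<gamma> k"
    using toeplitz_subshift_similar[OF S, of \<alpha> \<gamma> p 0] assms(2,3) self_mem_closure_orbit \<alpha>(2) by blast
  have "i \<in> Per p \<alpha>" for i using similar_Per_iff[OF k dvd_refl, of i] P by simp
  then have "\<alpha> (i + int p) = \<alpha> i" for i by (intro Per_cong) auto
  then have "(shift ^^ p) \<alpha> = \<alpha>" by (simp add: funpow_shift)
  then show False using \<alpha>(1) assms(3) unfolding periodic_seq_def by blast
qed

text \<open>If the terms were bounded by \<open>M\<close>, every essential period would divide
  \<open>fact M\<close>, and the generating sequence would be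
  \<open>fact M\<close>-periodic.\<close>

lemma infinite_range_pre_factorization:
  assumes S: "toeplitz_subshift n S"
  shows "infinite (range (pre_factorization (scale S)))"
proof
  assume fin: "finite (range (pre_factorization (scale S)))"
  obtain \<alpha> where \<alpha>: "(\<Union>p\<in>{0<..}. Per p \<alpha>) = UNIV" "S = closure (orbit \<alpha>)"
    using S by (auto simp: toeplitz_subshift_def toeplitz_seq_def)
  have mem: "\<alpha> \<in> S" using \<alpha>(2) self_mem_closure_orbit by blast
  define M where "M = Max (range (pre_factorization (scale S)))"
  have "i \<in> Per (fact M) \<alpha>" for i
  proof -
    have "i \<in> (\<Union>p\<in>{0<..}. Per p \<alpha>)" by (simp add: \<alpha>(1))
    then obtain q where q: "q > 0" "i \<in> Per q \<alpha>" by auto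
    then have "Per q \<alpha> \<noteq> {}" by blast
    then obtain p where p: "essential_period \<alpha> p" "Per p \<alpha> = Per q \<alpha>"
      using ex_essential_period[OF q(1)] by blast
    have "p \<le> pre_factorization (scale S) p"
      by (rule dvd_imp_le[OF essential_period_dvd_pre_factorization[OF S mem p(1)] pre_factorization_pos])
    also have "\<dots> \<le> M" unfolding M_def using fin by (intro Max_ge) auto
    finally have "p dvd fact M" using p(1) by (intro dvd_fact) (auto simp: essential_period_def)
    then show ?thesis using Per_dvd[of p "fact M" \<alpha>] p(2) q(2) by blast
  qed
  then show False using Per_ne_UNIV[OF S mem, of "fact M"] by auto
qed

text \<open>An infinite range leaves infinitely many indices of first occurrences, so
  \<open>enumerate\<close> lists them all. Afterwards only the set of terms matters, not their
  order.\<close>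

lemma range_natural_factorization:
  assumes "infinite (range (pre_factorization k))"
  shows "range (natural_factorization k) = range (pre_factorization k) - {1}"
proof -
  define A where "A = {t. pre_factorization k t \<noteq> 1 \<and> (\<forall>s<t. pre_factorization k s \<noteq> pre_factorization k t)}"
  have "x \<in> pre_factorization k ` A" if x: "x \<in> range (pre_factorization k)" "x \<noteq> 1" for x
  proof -
    define t where "t = (LEAST t. pre_factorization k t = x)"
    obtain u where "pre_factorization k u = x" using x(1) by blast
    then have t: "pre_factorization k t = x" unfolding t_def by (rule LeastI)
    have "pre_factorization k s \<noteq> x" if "s < t" for s
      using not_less_Least[OF that[unfolded t_def]] .
    then have "t \<in> A" using x(2) t by (simp add: A_def)
    then show ?thesis using t by blast
  qed
  then have A: "pre_factorization k ` A = range (pre_factorization k) - {1}"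
    by (auto simp: A_def)
  then have "infinite (pre_factorization k ` A)" using assms by simp
  then have "infinite A" using finite_imageI by blast
  then have "range (enumerate A) = A" by (rule range_enumerate)
  moreover have "natural_factorization k = pre_factorization k \<circ> enumerate A"
    by (simp add: natural_factorization_def A_def)
  ultimately show ?thesis using A by (metis image_comp)
qed

section \<open>Filled blocks\<close>

lemma filled_blocks_iff:
  "(a, b) \<in> filled_blocks p \<alpha> \<longleftrightarrow>
     a \<le> b \<and> {a..b} \<subseteq> Per p \<alpha> \<and> a - 1 \<notin> Per p \<alpha> \<and> b + 1 \<notin> Per p \<alpha>"
  by (auto simp: filled_blocks_def skeleton_def)

text \<open>The block extends from the last hole before \<open>c\<close> to the first hole after
  \<open>d\<close>.\<close>

lemma ex_filled_block:
  assumes "h \<notin> Per p \<alpha>" "h' \<notin> Per p \<alpha>" "h < c" "c \<le> d" "d < h'" "{c..d} \<subseteq> Per p \<alpha>"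
  shows "\<exists>a b. (a, b) \<in> filled_blocks p \<alpha> \<and> h < a \<and> a \<le> c \<and> d \<le> b \<and> b < h'"
proof -
  define A where "A = {h..<c} - Per p \<alpha>"
  define B where "B = {d<..h'} - Per p \<alpha>"
  have A: "finite A" "h \<in> A" and B: "finite B" "h' \<in> B" using assms by (simp_all add: A_def B_def)
  have MA: "Max A \<in> A" "h \<le> Max A" using A by (auto intro: Max_in)
  have MB: "Min B \<in> B" "Min B \<le> h'" using B by (auto intro: Min_in)
  have "i \<in> Per p \<alpha>" if "Max A < i" "i < c" for i
  proof (rule ccontr)
    assume "i \<notin> Per p \<alpha>"
    then have "i \<in> A" using that MA by (auto simp: A_def)
    then show False using Max_ge[OF A(1)] that(1) by fastforce
  qed
  moreover have "i \<in> Per p \<alpha>" if "d < i" "i < Min B" for i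
  proof (rule ccontr)
    assume "i \<notin> Per p \<alpha>"
    then have "i \<in> B" using that MB by (auto simp: B_def)
    then show False using Min_le[OF B(1)] that(2) by fastforce
  qed
  ultimately have "i \<in> Per p \<alpha>" if "Max A < i" "i < Min B" for i
    using that assms(6) by (cases "i < c"; cases "d < i") auto
  then have "(Max A + 1, Min B - 1) \<in> filled_blocks p \<alpha>"
    using MA(1) MB(1) assms(4) by (auto simp: filled_blocks_iff A_def B_def)
  moreover have "Max A + 1 \<le> c" "d \<le> Min B - 1" using MA(1) MB(1) by (auto simp: A_def B_def)
  ultimately show ?thesis using MA(2) MB(2)
    by (intro exI[of _ "Max A + 1"] exI[of _ "Min B - 1"]) auto
qed

lemma filled_blocks_similar:
  assumes "similar p r \<gamma> \<delta> k" "(a, b) \<in> filled_blocks p \<gamma>"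
  shows "(a + k, b + k) \<in> filled_blocks p \<delta>"
proof -
  have P: "i \<in> Per p \<gamma> \<longleftrightarrow> i + k \<in> Per p \<delta>" for i by (rule similar_Per_iff[OF assms(1) dvd_refl])
  have "i \<in> Per p \<delta>" if "a + k \<le> i" "i \<le> b + k" for i
  proof -
    have "i - k \<in> {a..b}" using that by auto
    then have "i - k \<in> Per p \<gamma>" using assms(2) by (auto simp: filled_blocks_iff)
    then show ?thesis using P[of "i - k"] by simp
  qed
  moreover have "a + k - 1 \<notin> Per p \<delta>" "b + k + 1 \<notin> Per p \<delta>"
    using P[of "a - 1"] P[of "b + 1"] assms(2) by (auto simp: filled_blocks_iff algebra_simps)
  ultimately show ?thesis using assms(2) by (auto simp: filled_blocks_iff)
qed

lemma toeplitz_growing_blocks_long: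
  assumes "S \<in> toeplitz_growing n" "\<gamma> \<in> S"
  shows "\<exists>B. \<forall>p>B. p \<in> range (pre_factorization (scale S)) \<longrightarrow>
      (\<forall>a b. (a, b) \<in> filled_blocks p \<gamma> \<longrightarrow> L \<le> b - a)"
proof -
  have S: "toeplitz_subshift n S" using assms(1) by (simp add: toeplitz_growing_def)
  obtain \<alpha> where \<alpha>: "\<alpha> \<in> S" "(\<lambda>t. min_block_length (tau S t) \<alpha>) \<longlonglongrightarrow> \<infinity>"
    using assms(1) by (auto simp: toeplitz_growing_def growing_blocks_def)
  have "\<forall>\<^sub>F t in sequentially. enat (nat L + 1) < min_block_length (tau S t) \<alpha>"
    by (rule order_tendstoD(1)[OF \<alpha>(2)]) simp
  then obtain m where m: "\<And>t. t \<ge> m \<Longrightarrow> enat (nat L + 1) < min_block_length (tau S t) \<alpha>"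
    by (auto simp: eventually_sequentially)
  \<comment> \<open>A term above \<open>B\<close> differs from 1 and from the first terms, so its
    index is in the range where the blocks are long.\<close>
  define B where "B = max 1 (Max (tau S ` {..m}))"
  have "L \<le> b - a"
    if p: "p > B" "p \<in> range (pre_factorization (scale S))" and ab: "(a, b) \<in> filled_blocks p \<gamma>" for p a b
  proof -
    have "p \<in> range (tau S)"
      using p range_natural_factorization[OF infinite_range_pre_factorization[OF S]]
      by (auto simp: tau_def[abs_def] B_def)
    then obtain t where t: "p = tau S t" by blast
    have "t \<ge> m"
    proof (rule ccontr)
      assume "\<not> t \<ge> m"
      then have "tau S t \<le> Max (tau S ` {..m})" by (intro Max_ge) auto
      then have "p \<le> B" using t by (simp add: B_def max_def)
      then show False using p(1) by simp
    qed
    have "p > 0" using p(1) by (simp add: B_def)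
    obtain k where k: "similar p 0 \<gamma> \<alpha> k"
      using toeplitz_subshift_similar[OF S assms(2) \<alpha>(1) \<open>p > 0\<close>] by blast
    have "min_block_length p \<alpha> \<le> enat (card {a + k..b + k})"
      unfolding min_block_length_def
      using filled_blocks_similar[OF k ab] by (intro INF_lower2) auto
    then have "enat (nat L + 1) < enat (card {a + k..b + k})"
      using m[OF \<open>t \<ge> m\<close>] t by (meson less_le_trans)
    then show ?thesis by simp
  qed
  then show ?thesis by blast
qed

text \<open>Terms exceeding the one at index \<open>q\<close> have a later index and are multiples
  of the essential period \<open>q\<close>, so their skeletons have filled positions; holes repeat
  modulo \<open>p\<close> and enclose one. This guarantees a cut, hence a nonempty set of
  patterns.\<close>

lemma ex_large_period_filled_block:
  assumes S: "toeplitz_subshift n S" and \<gamma>: "\<gamma> \<in> S"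
  shows "\<exists>p>B. p \<in> range (pre_factorization (scale S)) \<and> (\<exists>a b. (a, b) \<in> filled_blocks p \<gamma>)"
proof -
  let ?f = "pre_factorization (scale S)"
  obtain q where "essential_period \<gamma> q"
    using recognizes_iff_essential[OF S \<gamma>, of 1] by (auto simp: recognizes_def)
  then have q: "q dvd ?f q" "Per q \<gamma> \<noteq> {}" "q > 0"
    using essential_period_dvd_pre_factorization[OF S \<gamma>] by (auto simp: essential_period_def)
  have "\<not> range ?f \<subseteq> {..max B (?f q)}"
    using infinite_range_pre_factorization[OF S] finite_subset by blast
  then obtain t where "?f t \<notin> {..max B (?f q)}" by blast
  then have t: "?f t > B" "?f t > ?f q" by simp_all
  have "q \<le> t"
  proof (rule ccontr)
    assume "\<not> q \<le> t"
    then have "?f t \<le> ?f q" by (intro dvd_imp_le[OF pre_factorization_dvd pre_factorization_pos]) simp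
    then show False using t(2) by simp
  qed
  define p where "p = ?f t"
  have p: "p > 0" "q dvd p"
    using dvd_trans[OF q(1) pre_factorization_dvd[OF \<open>q \<le> t\<close>]] pre_factorization_pos by (auto simp: p_def)
  obtain i where i: "i \<in> Per p \<gamma>" using q(2) Per_dvd[OF p(2)] by blast
  obtain h where h: "h \<notin> Per p \<gamma>" using Per_ne_UNIV[OF S \<gamma> p(1)] by blast
  have hp: "h + int p * k \<notin> Per p \<gamma>" for k using h Per_mem_cong[of p "h + int p * k" h \<gamma>] by simp
  define c where "c = \<bar>h - i\<bar> + 1"
  have c: "1 * c \<le> int p * c" using p(1) by (intro mult_right_mono) (auto simp: c_def)
  have "h - c < i" "i < h + c" by (auto simp: c_def)
  then have "h + int p * (- c) < i" "i < h + int p * c" using c unfolding mult_minus_right by linarith+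
  from ex_filled_block[OF hp hp this(1) order_refl this(2)] i show ?thesis
    using t(1) by (auto simp: p_def)
qed

section \<open>Conjugacies between Toeplitz subshifts and invariance of the scale\<close>

lemma compact_toeplitz_subshift: "toeplitz_subshift n S \<Longrightarrow> compact S"
  using subshift_toeplitz[of n S] closed_Int_compact[OF _ compact_full_shift, of S n]
  by (auto simp: subshift_def Int_absorb2)

lemma shift_mem_toeplitz_subshift: "toeplitz_subshift n S \<Longrightarrow> \<alpha> \<in> S \<Longrightarrow> shift \<alpha> \<in> S"
  using subshift_toeplitz[of n S] by (auto simp: subshift_def)

lemma conjugacy_inverse:
  assumes S: "toeplitz_subshift n S" and fg: "homeomorphism S T f g"
    and comm: "\<And>\<alpha>. \<alpha> \<in> S \<Longrightarrow> f (shift \<alpha>) = shift (f \<alpha>)" and \<beta>: "\<beta> \<in> T"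
  shows "g (shift \<beta>) = shift (g \<beta>)"
proof -
  have g: "g \<beta> \<in> S" "f (g \<beta>) = \<beta>" using fg \<beta> by (auto simp: homeomorphism_def)
  have "shift (g \<beta>) \<in> S" using S g(1) by (rule shift_mem_toeplitz_subshift)
  then have "g (f (shift (g \<beta>))) = shift (g \<beta>)" using fg by (simp add: homeomorphism_def)
  then show ?thesis using comm[OF g(1)] g(2) by simp
qed

lemma top_conjugate_sym:
  assumes S: "toeplitz_subshift n S" and ST: "top_conjugate S T"
  shows "top_conjugate T S"
proof -
  obtain f g where fg: "homeomorphism S T f g" and comm: "\<And>\<alpha>. \<alpha> \<in> S \<Longrightarrow> f (shift \<alpha>) = shift (f \<alpha>)"
    using ST by (auto simp: top_conjugate_def)
  then show ?thesis
    using homeomorphism_symD[OF fg] conjugacy_inverse[OF S fg comm] by (auto simp: top_conjugate_def)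
qed

text \<open>The image of \<alpha> serves as \<beta>; both directions of the homeomorphism are block
  codes, and their radii are raised to a common nonnegative one.\<close>

lemma top_conjugate_local_codes:
  assumes S: "toeplitz_subshift n S" and T: "toeplitz_subshift n T" and ST: "top_conjugate S T" and \<alpha>: "\<alpha> \<in> S"
  shows "\<exists>\<beta>\<in>T. \<exists>r\<ge>0. local_code r \<alpha> \<beta> \<and> local_code r \<beta> \<alpha>"
proof -
  obtain f g where fg: "homeomorphism S T f g" and comm: "\<And>\<alpha>. \<alpha> \<in> S \<Longrightarrow> f (shift \<alpha>) = shift (f \<alpha>)"
    using ST by (auto simp: top_conjugate_def)
  note comm' = conjugacy_inverse[OF S fg comm]
  have f: "f \<alpha> \<in> T" "g (f \<alpha>) = \<alpha>" "continuous_on S f" "continuous_on T g"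
    using fg \<alpha> by (auto simp: homeomorphism_def)
  note S' = toeplitz_subshift_eq_closure[OF S \<alpha>] and T' = toeplitz_subshift_eq_closure[OF T f(1)]
  obtain r where r: "local_code r \<alpha> (f \<alpha>)"
    using conjugacy_local_code[of \<alpha> f \<alpha>, folded S', OF compact_toeplitz_subshift[OF S] f(3) comm \<alpha>]
    by blast
  obtain s where s: "local_code s (f \<alpha>) \<alpha>"
    using conjugacy_local_code[of "f \<alpha>" g "f \<alpha>", folded T', OF compact_toeplitz_subshift[OF T] f(4) comm' f(1)] f(2)
    by auto
  have "local_code (max 0 (max r s)) \<alpha> (f \<alpha>)" "local_code (max 0 (max r s)) (f \<alpha>) \<alpha>"
    by (rule local_code_mono[OF r], simp) (rule local_code_mono[OF s], simp)
  then show ?thesis using f(1) by (intro bexI[of _ "f \<alpha>"] exI[of _ "max 0 (max r s)"]) auto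
qed

text \<open>Block codes in both directions preserve the recognizable numbers, which determine the
  scale.\<close>

lemma scale_eq_of_top_conjugate:
  assumes S: "toeplitz_subshift n S" and T: "toeplitz_subshift n T" and ST: "top_conjugate S T"
  shows "scale S = scale T"
proof
  fix i
  obtain \<alpha> where \<alpha>: "\<alpha> \<in> S" using S self_mem_closure_orbit by (auto simp: toeplitz_subshift_def)
  obtain \<beta> r where \<beta>: "\<beta> \<in> T" "local_code r \<alpha> \<beta>" "local_code r \<beta> \<alpha>"
    using top_conjugate_local_codes[OF assms \<alpha>] by blast
  have "recognizes \<alpha> q \<longleftrightarrow> recognizes \<beta> q" for q
    using recognizes_local_code \<beta>(2,3) by blast
  then show "scale S i = scale T i"
    by (simp add: scale_eq_recognizes[OF S \<alpha>] scale_eq_recognizes[OF T \<beta>(1)])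
qed

section \<open>Block patterns\<close>

text \<open>After cutting at \<open>s\<close> modulo \<open>p\<close>, only the equality of words is
  recorded and not the words themselves, because a conjugacy changes the letters.\<close>

definition block_eq :: "nat \<Rightarrow> (int \<Rightarrow> nat) \<Rightarrow> int \<Rightarrow> int \<Rightarrow> int \<Rightarrow> bool" where
  "block_eq p \<alpha> s i j \<longleftrightarrow> (\<forall>x\<in>{0..<int p}. \<alpha> (s + int p * i + x) = \<alpha> (s + int p * j + x))"

text \<open>A midpoint is far from both ends of a long block, and moves by at most \<open>r\<close>
  if each end does.\<close>

definition block_start :: "nat \<Rightarrow> (int \<Rightarrow> nat) \<Rightarrow> int \<Rightarrow> bool" where
  "block_start p \<alpha> s \<longleftrightarrow> (\<exists>a b. (a, b) \<in> filled_blocks p \<alpha> \<and> s = (a + b) div 2)"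

text \<open>A triple \<open>(i, j, e)\<close> prescribes whether words \<open>i\<close> and
  \<open>j\<close> are equal. Patterns are lists so that they form a countable type and can be
  numbered.\<close>

definition realizes :: "nat \<Rightarrow> (int \<Rightarrow> nat) \<Rightarrow> (int \<times> int \<times> bool) list \<Rightarrow> bool" where
  "realizes p \<alpha> L \<longleftrightarrow> (\<exists>s. block_start p \<alpha> s \<and> (\<forall>(i, j, e)\<in>set L. block_eq p \<alpha> s i j = e))"

text \<open>A window of radius \<open>max r (int p)\<close> determines the offset of its centre in a
  \<open>p\<close>-word and contains that word. Equal windows of \<gamma> thus lie over equal words
  of \<gamma>, hence of \<delta>, at the same offset.\<close>

lemma local_code_of_block_patterns:
  assumes rec: "recognizes \<gamma> p" and "p > 0" and imp: "\<And>i j. block_eq p \<gamma> 0 i j \<Longrightarrow> block_eq p \<delta> 0 i j"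
  shows "\<exists>r. local_code r \<gamma> \<delta>"
proof -
  obtain r where r: "\<And>k l. agree r \<gamma> k \<gamma> l \<Longrightarrow> int p dvd k - l"
    using rec by (auto simp: recognizes_def)
  have "\<delta> k = \<delta> l" if kl: "agree (max r (int p)) \<gamma> k \<gamma> l" for k l
  proof -
    have "int p dvd k - l" by (rule r[OF agree_mono[OF kl]]) simp
    then have mod: "k mod int p = l mod int p" by (simp add: mod_eq_dvd_iff)
    define x where "x = k mod int p"
    have x: "0 \<le> x" "x < int p" using \<open>p > 0\<close> by (simp_all add: x_def)
    have k: "int p * (k div int p) = k - x" by (simp add: x_def minus_mod_eq_mult_div)
    have l: "int p * (l div int p) = l - x" by (simp add: x_def mod minus_mod_eq_mult_div)
    have "block_eq p \<gamma> 0 (k div int p) (l div int p)"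
      unfolding block_eq_def k l
    proof
      fix y assume "y \<in> {0..<int p}"
      then have "\<bar>y - x\<bar> \<le> max r (int p)" using x by auto
      from agreeD[OF kl this] show "\<gamma> (0 + (k - x) + y) = \<gamma> (0 + (l - x) + y)"
        by (simp add: algebra_simps)
    qed
    then have "block_eq p \<delta> 0 (k div int p) (l div int p)" by (rule imp)
    then have "\<delta> (0 + (k - x) + x) = \<delta> (0 + (l - x) + x)"
      unfolding block_eq_def k l using x by (metis atLeastLessThan_iff)
    then show ?thesis by simp
  qed
  then show ?thesis unfolding local_code_def by blast
qed

text \<open>Words \<open>i\<close> and \<open>j\<close> lie within distance
  \<open>int p * (max \<bar>i\<bar> \<bar>j\<bar> + 1)\<close> of the cut.\<close>

lemma block_eq_agree:
  assumes "agree r \<gamma> s \<delta> t" "int p * (max \<bar>i\<bar> \<bar>j\<bar> + 1) \<le> r"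
  shows "block_eq p \<gamma> s i j \<longleftrightarrow> block_eq p \<delta> t i j"
proof -
  have bound: "\<bar>int p * k + x\<bar> \<le> r" if "x \<in> {0..<int p}" "\<bar>k\<bar> \<le> max \<bar>i\<bar> \<bar>j\<bar>" for x k
  proof -
    have "\<bar>int p * k + x\<bar> \<le> int p * \<bar>k\<bar> + int p" using that(1) abs_triangle_ineq[of "int p * k" x] by (auto simp: abs_mult)
    also have "\<dots> = int p * (\<bar>k\<bar> + 1)" by (simp add: algebra_simps)
    also have "\<dots> \<le> int p * (max \<bar>i\<bar> \<bar>j\<bar> + 1)" using that(2) by (intro mult_left_mono) auto
    finally show ?thesis using assms(2) by linarith
  qed
  have "\<gamma> (s + int p * k + x) = \<delta> (t + int p * k + x)" if "x \<in> {0..<int p}" "\<bar>k\<bar> \<le> max \<bar>i\<bar> \<bar>j\<bar>" for x k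
    using agreeD[OF assms(1) bound[OF that]] by (simp add: add.assoc)
  then show ?thesis by (simp add: block_eq_def)
qed

text \<open>Each finite part of the pattern of \<alpha> cut at \<open>s\<close> occurs in \<beta> at
  some cut; a limit \<delta> of translates of \<beta> has the whole pattern. As patterns record
  inequalities too, block codes arise in both directions.\<close>

lemma top_conjugate_of_realizes:
  assumes S: "toeplitz_subshift n S" and T: "toeplitz_subshift n T" and \<alpha>: "\<alpha> \<in> S" and \<beta>: "\<beta> \<in> T"
    and p: "p > 0" "recognizes \<alpha> p" "recognizes \<beta> p" "block_start p \<alpha> s"
    and imp: "\<And>L. realizes p \<alpha> L \<Longrightarrow> realizes p \<beta> L"
  shows "top_conjugate S T"
proof -
  have "\<exists>t. \<forall>i j. \<bar>i\<bar> \<le> int m \<and> \<bar>j\<bar> \<le> int m \<longrightarrow> block_eq p \<beta> t i j = block_eq p \<alpha> s i j" for m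
  proof -
    let ?X = "(\<lambda>(i, j). (i, j, block_eq p \<alpha> s i j)) ` ({-int m..int m} \<times> {-int m..int m})"
    have "finite ?X" by simp
    then obtain L where L: "set L = ?X" using finite_list by blast
    have "realizes p \<alpha> L" unfolding realizes_def using p(4) by (intro exI[of _ s]) (auto simp: L)
    from imp[OF this] obtain t where t: "\<forall>(i, j, e)\<in>?X. block_eq p \<beta> t i j = e"
      unfolding realizes_def L by blast
    have "block_eq p \<beta> t i j = block_eq p \<alpha> s i j" if "\<bar>i\<bar> \<le> int m" "\<bar>j\<bar> \<le> int m" for i j
      using t that by (force simp: abs_le_iff)
    then show ?thesis by blast
  qed
  then obtain t where t: "\<And>m i j. \<bar>i\<bar> \<le> int m \<Longrightarrow> \<bar>j\<bar> \<le> int m \<Longrightarrow> block_eq p \<beta> (t m) i j = block_eq p \<alpha> s i j"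
    by metis
  define X where "X m = (\<lambda>x. \<beta> (x + t m))" for m
  have shift_mem: "(\<lambda>x. \<epsilon> (x + k)) \<in> U" if "toeplitz_subshift n U" "\<epsilon> \<in> U" for U \<epsilon> k
    using translate_mem_closure_orbit[of \<epsilon> \<epsilon> k] self_mem_closure_orbit[of \<epsilon>]
      toeplitz_subshift_eq_closure[OF that] by simp
  have "X m \<in> T" for m unfolding X_def using T \<beta> by (rule shift_mem)
  then obtain \<delta> h where \<delta>: "\<delta> \<in> T" and h: "strict_mono h"
      and lim: "\<forall>r. \<forall>\<^sub>F m in sequentially. agree r (X (h m)) 0 \<delta> 0"
    using compact_limit_point[of T X, OF compact_toeplitz_subshift[OF T]] by blast
  define \<gamma> where "\<gamma> = (\<lambda>x. \<alpha> (x + s))"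
  have \<gamma>: "\<gamma> \<in> S" unfolding \<gamma>_def using S \<alpha> by (rule shift_mem)
  have eq: "block_eq p \<gamma> 0 i j = block_eq p \<delta> 0 i j" for i j
  proof -
    have "\<forall>\<^sub>F m in sequentially. agree (int p * (max \<bar>i\<bar> \<bar>j\<bar> + 1)) (X (h m)) 0 \<delta> 0 \<and> m \<ge> nat (max \<bar>i\<bar> \<bar>j\<bar>)"
      by (rule eventually_conj[OF spec[OF lim] eventually_ge_at_top])
    then obtain m where m: "agree (int p * (max \<bar>i\<bar> \<bar>j\<bar> + 1)) (X (h m)) 0 \<delta> 0" "m \<ge> nat (max \<bar>i\<bar> \<bar>j\<bar>)"
      using eventually_happens'[OF sequentially_bot] by blast
    have "h m \<ge> m" using h by (rule seq_suble)
    then have "block_eq p \<beta> (t (h m)) i j = block_eq p \<alpha> s i j" using m(2) by (intro t) auto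
    moreover have "block_eq p \<delta> 0 i j = block_eq p (X (h m)) 0 i j"
      using block_eq_agree[OF m(1) order_refl] by blast
    moreover have "block_eq p (X (h m)) 0 i j = block_eq p \<beta> (t (h m)) i j"
      by (simp add: block_eq_def X_def add_ac)
    moreover have "block_eq p \<gamma> 0 i j = block_eq p \<alpha> s i j"
      by (simp add: block_eq_def \<gamma>_def add_ac)
    ultimately show ?thesis by simp
  qed
  have "recognizes \<gamma> p" "recognizes \<delta> p"
    using recognizes_transfer[OF S \<alpha> \<gamma> p(2)] recognizes_transfer[OF T \<beta> \<delta> p(3)] .
  then obtain r r' where "local_code r \<gamma> \<delta>" "local_code r' \<delta> \<gamma>"
    using local_code_of_block_patterns[of _ p] p(1) eq by metis
  from top_conjugate_of_local_codes[OF this] show ?thesis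
    using toeplitz_subshift_eq_closure[OF S \<gamma>] toeplitz_subshift_eq_closure[OF T \<delta>] by simp
qed

lemma local_code_Per:
  assumes "local_code r \<alpha> \<beta>" "{i - r..i + r} \<subseteq> Per p \<alpha>"
  shows "i \<in> Per p \<beta>"
proof (rule PerI)
  fix k
  have "\<alpha> (i + int p * k + j) = \<alpha> (i + j)" if "\<bar>j\<bar> \<le> r" for j
  proof -
    have "i + j \<in> {i - r..i + r}" using that by auto
    then have "i + j \<in> Per p \<alpha>" using assms(2) by blast
    then show ?thesis by (rule Per_cong) simp
  qed
  then have "agree r \<alpha> (i + int p * k) \<alpha> i" unfolding agree_def by blast
  then show "\<beta> (i + int p * k) = \<beta> i" using assms(1) by (simp add: local_code_def)
qed

text \<open>Equal words stay equal when extended by \<open>2 * r\<close> on both sides, since the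
  letters near the cuts are \<open>p\<close>-periodic. Of this margin, \<open>r\<close> pays for the
  displacement of the cut and \<open>r\<close> for the coding window.\<close>

lemma local_code_block_eq:
  assumes code: "local_code r \<alpha> \<beta>" and per: "{s - 2 * r..s + 2 * r} \<subseteq> Per p \<alpha>" and t: "\<bar>t - s\<bar> \<le> r"
    and eq: "block_eq p \<alpha> s i j"
  shows "block_eq p \<beta> t i j"
  unfolding block_eq_def
proof
  fix x assume x: "x \<in> {0..<int p}"
  have "\<alpha> (s + int p * i + z) = \<alpha> (s + int p * j + z)" if z: "- 2 * r \<le> z" "z < int p + 2 * r" for z
  proof -
    consider "z < 0" | "z \<in> {0..<int p}" | "z \<ge> int p" by force
    then show ?thesis
    proof cases
      case 1
      then have "s + z \<in> {s - 2 * r..s + 2 * r}" using z t by auto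
      then have per': "s + z \<in> Per p \<alpha>" using per by blast
      have "\<alpha> (s + int p * k + z) = \<alpha> (s + z)" for k by (rule Per_cong[OF per']) simp
      then show ?thesis by simp
    next
      case 2
      then show ?thesis using eq by (simp add: block_eq_def)
    next
      case 3
      then have "s + z - int p \<in> {s - 2 * r..s + 2 * r}" using z t by auto
      then have per': "s + z - int p \<in> Per p \<alpha>" using per by blast
      have "\<alpha> (s + int p * k + z) = \<alpha> (s + z - int p)" for k
      proof (rule Per_cong[OF per'])
        have "s + int p * k + z - (s + z - int p) = int p * (k + 1)" by (simp add: algebra_simps)
        then show "int p dvd s + int p * k + z - (s + z - int p)" by simp
      qed
      then show ?thesis by simp
    qed
  qed
  note * = this
  have "\<alpha> (t + int p * i + x + y) = \<alpha> (t + int p * j + x + y)" if y: "\<bar>y\<bar> \<le> r" for y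
  proof -
    have "- 2 * r \<le> t - s + x + y" "t - s + x + y < int p + 2 * r" using y t x by auto
    from *[OF this] show ?thesis by (simp add: algebra_simps)
  qed
  then have "agree r \<alpha> (t + int p * i + x) \<alpha> (t + int p * j + x)" unfolding agree_def by blast
  then show "\<beta> (t + int p * i + x) = \<beta> (t + int p * j + x)" using code by (simp add: local_code_def)
qed

text \<open>The code keeps the block filled up to \<open>r\<close> from its ends, and the reverse
  code forces a hole of \<beta> within \<open>r\<close> of each hole of \<alpha>. So the ends move
  by at most \<open>r\<close>, and the length bound leaves the margins that
  \<open>local_code_block_eq\<close> asks for around both midpoints.\<close>

lemma local_codes_block_start:
  assumes code: "local_code r \<alpha> \<beta>" "local_code r \<beta> \<alpha>" and "r \<ge> 0"
    and ab: "(a, b) \<in> filled_blocks p \<alpha>" and len: "8 * r + 8 \<le> b - a"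
  shows "\<exists>t. block_start p \<beta> t \<and> (\<forall>i j. block_eq p \<beta> t i j = block_eq p \<alpha> ((a + b) div 2) i j)"
proof -
  have in\<alpha>: "{a..b} \<subseteq> Per p \<alpha>" and out\<alpha>: "a - 1 \<notin> Per p \<alpha>" "b + 1 \<notin> Per p \<alpha>"
    using ab by (auto simp: filled_blocks_iff)
  have in\<beta>: "{a + r..b - r} \<subseteq> Per p \<beta>"
  proof
    fix i assume "i \<in> {a + r..b - r}"
    then have "{i - r..i + r} \<subseteq> Per p \<alpha>" by (intro subset_trans[OF _ in\<alpha>]) auto
    then show "i \<in> Per p \<beta>" by (rule local_code_Per[OF code(1)])
  qed
  have hole: "\<exists>h\<in>{i - r..i + r}. h \<notin> Per p \<beta>" if "i \<notin> Per p \<alpha>" for i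
    using local_code_Per[OF code(2), of i p] that by blast
  obtain h h' where h: "h \<in> {a - 1 - r..a - 1 + r}" "h \<notin> Per p \<beta>"
      and h': "h' \<in> {b + 1 - r..b + 1 + r}" "h' \<notin> Per p \<beta>"
    using hole[OF out\<alpha>(1)] hole[OF out\<alpha>(2)] by blast
  obtain a' b' where ab': "(a', b') \<in> filled_blocks p \<beta>" "h < a'" "a' \<le> a + r" "b - r \<le> b'" "b' < h'"
    using ex_filled_block[OF h(2) h'(2) _ _ _ in\<beta>] h(1) h'(1) len \<open>r \<ge> 0\<close> by auto
  define s where "s = (a + b) div 2"
  define t where "t = (a' + b') div 2"
  have ts: "\<bar>t - s\<bar> \<le> r" using ab' h(1) h'(1) unfolding s_def t_def by auto
  have s: "a + 4 * r \<le> s" "s + 4 * r \<le> b" using len unfolding s_def by auto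
  have "{s - 2 * r..s + 2 * r} \<subseteq> Per p \<alpha>"
    using s \<open>r \<ge> 0\<close> by (intro subset_trans[OF _ in\<alpha>]) auto
  moreover have "{t - 2 * r..t + 2 * r} \<subseteq> Per p \<beta>"
    using s ts by (intro subset_trans[OF _ in\<beta>]) auto
  ultimately have "block_eq p \<beta> t i j = block_eq p \<alpha> s i j" for i j
    using local_code_block_eq[OF code(1), of s p t i j] local_code_block_eq[OF code(2), of t p s i j] ts
    by (auto simp: abs_minus_commute)
  moreover have "block_start p \<beta> t" using ab'(1) by (auto simp: block_start_def t_def)
  ultimately show ?thesis by (auto simp: s_def)
qed

text \<open>A pattern depends on a finite window around its cut; \<open>similar\<close> moves that
  window along with the filled block. The summand \<open>\<bar>s\<bar>\<close> in the radius brings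
  the window around \<open>s\<close> into one around 0.\<close>

lemma realizes_transfer:
  assumes S: "toeplitz_subshift n S" and "\<gamma> \<in> S" "\<delta> \<in> S" "p > 0" "realizes p \<gamma> L"
  shows "realizes p \<delta> L"
proof -
  obtain a b where ab: "(a, b) \<in> filled_blocks p \<gamma>"
      and L: "\<forall>(i, j, e)\<in>set L. block_eq p \<gamma> ((a + b) div 2) i j = e"
    using assms(5) by (auto simp: realizes_def block_start_def)
  define s where "s = (a + b) div 2"
  define m where "m = Max (insert 0 ((\<lambda>(i, j, e). max \<bar>i\<bar> \<bar>j\<bar>) ` set L))"
  have m: "max \<bar>i\<bar> \<bar>j\<bar> \<le> m" if "(i, j, e) \<in> set L" for i j e
  proof -
    have "max \<bar>i\<bar> \<bar>j\<bar> \<in> insert 0 ((\<lambda>(i, j, e). max \<bar>i\<bar> \<bar>j\<bar>) ` set L)" using that by force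
    then show ?thesis unfolding m_def by (intro Max_ge) auto
  qed
  obtain k where k: "similar p (int p * (m + 1) + \<bar>s\<bar>) \<gamma> \<delta> k"
    using toeplitz_subshift_similar[OF S assms(2-4)] by blast
  then have agree: "agree (int p * (m + 1)) \<gamma> (0 + s) \<delta> (k + s)"
    by (intro agree_translate[of "int p * (m + 1) + \<bar>s\<bar>"]) (auto simp: similar_def)
  have "block_eq p \<delta> (k + s) i j = e" if "(i, j, e) \<in> set L" for i j e
  proof -
    have "int p * (max \<bar>i\<bar> \<bar>j\<bar> + 1) \<le> int p * (m + 1)" using m[OF that] by (intro mult_left_mono) auto
    from block_eq_agree[OF agree this] show ?thesis using L that by (auto simp: s_def)
  qed
  moreover have "block_start p \<delta> (k + s)"
  proof -
    have "(a + k + (b + k)) div 2 = k + s" by (simp add: s_def)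
    then show ?thesis using filled_blocks_similar[OF k ab] unfolding block_start_def by metis
  qed
  ultimately show ?thesis unfolding realizes_def by blast
qed

text \<open>Growing blocks make the filled blocks long relative to the fixed coding radius for all
  large \<open>p\<close>. The pattern first passes to the image \<gamma> of \<alpha>, then within
  \<open>T\<close> to \<beta>.\<close>

lemma top_conjugate_imp_realizes:
  assumes S: "S \<in> toeplitz_growing n" and T: "toeplitz_subshift n T" and ST: "top_conjugate S T"
    and \<alpha>: "\<alpha> \<in> S" and \<beta>: "\<beta> \<in> T"
  shows "\<exists>B. \<forall>p>B. p \<in> range (pre_factorization (scale S)) \<longrightarrow> (\<forall>L. realizes p \<alpha> L \<longrightarrow> realizes p \<beta> L)"
proof -
  have S': "toeplitz_subshift n S" using S by (simp add: toeplitz_growing_def)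
  obtain \<gamma> r where \<gamma>: "\<gamma> \<in> T" and r: "r \<ge> 0" "local_code r \<alpha> \<gamma>" "local_code r \<gamma> \<alpha>"
    using top_conjugate_local_codes[OF S' T ST \<alpha>] by blast
  obtain B where B: "\<And>p a b. p > B \<Longrightarrow> p \<in> range (pre_factorization (scale S)) \<Longrightarrow>
      (a, b) \<in> filled_blocks p \<alpha> \<Longrightarrow> 8 * r + 8 \<le> b - a"
    using toeplitz_growing_blocks_long[OF S \<alpha>] by metis
  have "realizes p \<beta> L"
    if p: "p > B" "p \<in> range (pre_factorization (scale S))" and L: "realizes p \<alpha> L" for p L
  proof -
    obtain a b where ab: "(a, b) \<in> filled_blocks p \<alpha>"
        and L: "\<forall>(i, j, e)\<in>set L. block_eq p \<alpha> ((a + b) div 2) i j = e"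
      using L by (auto simp: realizes_def block_start_def)
    obtain t where "block_start p \<gamma> t" "\<And>i j. block_eq p \<gamma> t i j = block_eq p \<alpha> ((a + b) div 2) i j"
      using local_codes_block_start[OF r(2,3,1) ab B[OF p ab]] by blast
    then have "realizes p \<gamma> L" using L unfolding realizes_def by (intro exI[of _ t]) simp
    then show ?thesis using p(1) by (intro realizes_transfer[OF T \<gamma> \<beta>]) auto
  qed
  then show ?thesis by blast
qed

section \<open>A Borel selection of points\<close>

text \<open>The integers are enumerated by \<open>int_decode\<close>, so finite words describe basic
  open sets of the shift space.\<close>

definition meets :: "(int \<Rightarrow> nat) set \<Rightarrow> nat list \<Rightarrow> bool" where
  "meets S w \<longleftrightarrow> (\<exists>\<alpha>\<in>S. \<forall>i<length w. \<alpha> (int_decode i) = w ! i)"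

primrec lex_prefix :: "(int \<Rightarrow> nat) set \<Rightarrow> nat \<Rightarrow> nat list" where
  "lex_prefix S 0 = []"
| "lex_prefix S (Suc m) = lex_prefix S m @ [LEAST a. meets S (lex_prefix S m @ [a])]"

definition lex_point :: "(int \<Rightarrow> nat) set \<Rightarrow> int \<Rightarrow> nat" where
  "lex_point S x = lex_prefix S (Suc (int_encode x)) ! int_encode x"

lemma length_lex_prefix [simp]: "length (lex_prefix S m) = m"
  by (induction m) simp_all

lemma meets_lex_prefix:
  assumes "S \<noteq> {}"
  shows "meets S (lex_prefix S m)"
proof (induction m)
  case 0
  then show ?case using assms by (auto simp: meets_def)
next
  case (Suc m)
  then obtain \<alpha> where \<alpha>: "\<alpha> \<in> S" "\<And>i. i < m \<Longrightarrow> \<alpha> (int_decode i) = lex_prefix S m ! i"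
    by (auto simp: meets_def)
  have "meets S (lex_prefix S m @ [\<alpha> (int_decode m)])"
    using \<alpha> unfolding meets_def by (intro bexI[of _ \<alpha>]) (auto simp: nth_append less_Suc_eq)
  then show ?case unfolding lex_prefix.simps by (rule LeastI)
qed

lemma nth_lex_prefix: "i < m \<Longrightarrow> lex_prefix S m ! i = lex_point S (int_decode i)"
proof (induction m)
  case (Suc m)
  then show ?case by (cases "i = m") (simp_all add: nth_append lex_point_def)
qed simp

text \<open>Every prefix is extended by a point of \<open>S\<close>, and a long prefix covers any
  given window, so closedness applies.\<close>

lemma lex_point_mem:
  assumes "closed S" "S \<noteq> {}"
  shows "lex_point S \<in> S"
proof -
  have "\<exists>\<delta>\<in>S. agree r (lex_point S) 0 \<delta> 0" for r
  proof -
    define m where "m = Suc (Max (insert 0 (int_encode ` {-r..r})))"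
    obtain \<delta> where \<delta>: "\<delta> \<in> S" "\<And>i. i < m \<Longrightarrow> \<delta> (int_decode i) = lex_prefix S m ! i"
      using meets_lex_prefix[OF assms(2), of m] by (auto simp: meets_def)
    have "lex_point S j = \<delta> j" if "\<bar>j\<bar> \<le> r" for j
    proof -
      have "j \<in> {-r..r}" using that by auto
      then have "int_encode j \<le> Max (insert 0 (int_encode ` {-r..r}))" by (intro Max_ge) auto
      then have "int_encode j < m" by (simp add: m_def)
      then show ?thesis using \<delta>(2)[of "int_encode j"] nth_lex_prefix[of "int_encode j" m S] by simp
    qed
    then show ?thesis using \<delta>(1) by (auto simp: agree_def)
  qed
  then have "lex_point S \<in> closure S" by (simp add: closure_iff_agree)
  then show ?thesis using assms(1) by simp
qed

section \<open>Borel measurability of the selected point and its invariants\<close>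

lemma openin_hyperspace_meets:
  fixes U :: "'a::metric_space set"
  assumes "open U"
  shows "openin (hyperspace X) {A \<in> compacts X. A \<inter> U \<noteq> {}}"
proof -
  interpret Metric_space "compacts X" hausdorff_dist
    by (rule Metric_space_hausdorff_dist)
  have "\<exists>r>0. mball A r \<subseteq> {A \<in> compacts X. A \<inter> U \<noteq> {}}" if A: "A \<in> compacts X" "A \<inter> U \<noteq> {}" for A
  proof -
    obtain a where a: "a \<in> A" "a \<in> U" using A(2) by blast
    obtain r where r: "r > 0" "ball a r \<subseteq> U" using assms a(2) open_contains_ball by blast
    have "B \<inter> U \<noteq> {}" if B: "B \<in> mball A r" for B
    proof -
      have B': "B \<in> compacts X" "hausdorff_dist A B < r" using B by auto
      \<comment> \<open>Hausdorff closeness puts a point of \<open>B\<close> into the ball around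
        \<open>a\<close>, which lies in \<open>U\<close>.\<close>
      then have "infdist a B < r"
        using infdist_le_hausdorff_dist[OF A(1) B'(1) a(1)] by simp
      moreover have "B \<noteq> {}" using B'(1) by (auto simp: compacts_def)
      ultimately obtain b where "b \<in> B" "dist a b < r"
        by (auto simp: infdist_notempty cINF_less_iff)
      then have "b \<in> B \<inter> U" using r(2) by auto
      then show ?thesis by blast
    qed
    then show ?thesis using r(1) by (intro exI[of _ r]) auto
  qed
  then show ?thesis unfolding hyperspace_def openin_mtopology by auto
qed

lemma pred_meets: "Measurable.pred (toeplitz_growing_space n) (\<lambda>S. meets S w)"
proof -
  define U where "U = (\<Inter>i\<in>{..<length w}. (\<lambda>\<alpha> :: int \<Rightarrow> nat. \<alpha> (int_decode i)) -` {w ! i})"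
  have "open ((\<lambda>\<alpha> :: int \<Rightarrow> nat. \<alpha> j) -` {a})" for j a
    by (intro open_vimage open_discrete continuous_on_product_coordinates)
  then have "open U" unfolding U_def by auto
  let ?H = "hyperspace (full_shift n)"
  have "{A \<in> compacts (full_shift n). A \<inter> U \<noteq> {}} \<in> sets (borel_of ?H)"
    unfolding borel_of_def using openin_hyperspace_meets[OF \<open>open U\<close>]
    by (auto intro!: in_measure_of dest: openin_subset)
  then have "toeplitz_growing n \<inter> {A \<in> compacts (full_shift n). A \<inter> U \<noteq> {}} \<in> sets (toeplitz_growing_space n)"
    unfolding toeplitz_growing_space_def sets_restrict_space by blast
  also have "toeplitz_growing n \<inter> {A \<in> compacts (full_shift n). A \<inter> U \<noteq> {}} =
      {S \<in> space (toeplitz_growing_space n). meets S w}"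
    using toeplitz_growing_subset[of n]
    unfolding space_toeplitz_growing_space by (auto simp: meets_def U_def)
  finally show ?thesis by (simp add: pred_def)
qed

text \<open>The next letter is the least one satisfying a Borel condition, and there are only
  countably many prefixes to distinguish.\<close>

lemma measurable_lex_prefix:
  "(\<lambda>S. lex_prefix S m) \<in> measurable (toeplitz_growing_space n) (count_space UNIV)"
proof (induction m)
  case (Suc m)
  have "(\<lambda>S. LEAST a. meets S (w @ [a])) \<in> measurable (toeplitz_growing_space n) (count_space UNIV)" for w
    by (intro measurable_Least pred_meets)
  then have "(\<lambda>S. w @ [LEAST a. meets S (w @ [a])]) \<in> measurable (toeplitz_growing_space n) (count_space UNIV)" for w
    by (rule measurable_compose[where g = "\<lambda>a. w @ [a]"]) simp
  from measurable_compose_countable[OF this Suc] show ?case by simp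
qed simp

lemma measurable_lex_point:
  "(\<lambda>S. lex_point S x) \<in> measurable (toeplitz_growing_space n) (count_space UNIV)"
  unfolding lex_point_def
  by (rule measurable_compose[OF measurable_lex_prefix, where g = "\<lambda>w. w ! int_encode x"]) simp

lemma pred_lex_point_eq [measurable]:
  "Measurable.pred (toeplitz_growing_space n) (\<lambda>S. lex_point S x = lex_point S y)"
proof (rule measurable_compose_countable[OF _ measurable_lex_point, where f = "\<lambda>a S. a = lex_point S y"])
  show "Measurable.pred (toeplitz_growing_space n) (\<lambda>S. a = lex_point S y)" for a
    by (rule measurable_compose[OF measurable_lex_point, where g = "\<lambda>b. a = b"]) simp
qed

lemma pred_recognizes [measurable]:
  "Measurable.pred (toeplitz_growing_space n) (\<lambda>S. recognizes (lex_point S) q)"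
  unfolding recognizes_def agree_def by measurable

text \<open>All quantifiers range over countable types, down to equalities between letters of the
  selected point.\<close>

lemma pred_realizes [measurable]:
  "Measurable.pred (toeplitz_growing_space n) (\<lambda>S. realizes p (lex_point S) L)"
proof -
  have [measurable]: "Measurable.pred (toeplitz_growing_space n) (\<lambda>S. i \<in> Per p (lex_point S))" for i
    unfolding Per_def mem_Collect_eq by measurable
  have [measurable]: "Measurable.pred (toeplitz_growing_space n) (\<lambda>S. block_start p (lex_point S) s)" for s
    unfolding block_start_def filled_blocks_iff subset_iff by measurable
  have [measurable]: "Measurable.pred (toeplitz_growing_space n) (\<lambda>S. block_eq p (lex_point S) s i j)" for s i j
    unfolding block_eq_def by measurable
  show ?thesis unfolding realizes_def case_prod_beta by measurable
qed

lemma toeplitz_growing_lex_point: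
  assumes "S \<in> toeplitz_growing n"
  shows "toeplitz_subshift n S" "lex_point S \<in> S"
proof -
  show S: "toeplitz_subshift n S" using assms by (simp add: toeplitz_growing_def)
  then have "subshift n S" by (rule subshift_toeplitz)
  then show "lex_point S \<in> S" by (intro lex_point_mem) (auto simp: subshift_def)
qed

lemma enat_eqI_le:
  assumes "\<And>j. enat j \<le> x \<longleftrightarrow> enat j \<le> y"
  shows "x = y"
proof -
  have "u \<le> v" if "\<And>j. enat j \<le> u \<Longrightarrow> enat j \<le> v" for u v
    using that[of "Suc (the_enat v)"] that[of "the_enat u"] by (cases u; cases v) auto
  then show ?thesis using assms by (intro antisym) blast+
qed

text \<open>An extended natural is determined by the finite numbers below it, so each fibre is a
  countable intersection of recognizability conditions.\<close>

lemma measurable_scale: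
  "(\<lambda>S. scale S i) \<in> measurable (toeplitz_growing_space n) (count_space UNIV)"
proof -
  have "(\<lambda>S. scale S i) -` {e} \<inter> space (toeplitz_growing_space n) \<in> sets (toeplitz_growing_space n)" for e
  proof -
    have "{S \<in> space (toeplitz_growing_space n). \<forall>j. recognizes (lex_point S) (nth_prime i ^ j) = (enat j \<le> e)}
        \<in> sets (toeplitz_growing_space n)"
      by measurable
    also have "{S \<in> space (toeplitz_growing_space n). \<forall>j. recognizes (lex_point S) (nth_prime i ^ j) = (enat j \<le> e)}
        = (\<lambda>S. scale S i) -` {e} \<inter> space (toeplitz_growing_space n)"
    proof -
      have "(\<forall>j. recognizes (lex_point S) (nth_prime i ^ j) = (enat j \<le> e)) \<longleftrightarrow> scale S i = e"
        if "S \<in> toeplitz_growing n" for S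
        using enat_le_scale_iff[OF toeplitz_growing_lex_point[OF that]] enat_eqI_le[of "scale S i" e] by auto
      then show ?thesis by (auto simp: space_toeplitz_growing_space)
    qed
    finally show ?thesis .
  qed
  then show ?thesis by (simp add: measurable_count_space_eq2_countable)
qed

lemma measurable_pre_factorization:
  "(\<lambda>S. pre_factorization (scale S) t) \<in> measurable (toeplitz_growing_space n) (count_space UNIV)"
proof -
  let ?e = "\<lambda>S i. nth_prime i ^ the_enat (min (scale S i) (enat (t + 1)))"
  have e: "(\<lambda>S. ?e S i) \<in> measurable (toeplitz_growing_space n) (count_space UNIV)" for i
    by (rule measurable_compose[OF measurable_scale, where g = "\<lambda>x. nth_prime i ^ the_enat (min x (enat (t + 1)))"]) simp
  have "(\<lambda>S. \<Prod>i<m. ?e S i) \<in> measurable (toeplitz_growing_space n) (count_space UNIV)" for m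
  proof (induction m)
    case (Suc m)
    have "(\<lambda>S. (\<Prod>i<m. ?e S i) * ?e S m) \<in> measurable (toeplitz_growing_space n) (count_space UNIV)"
    proof (rule measurable_compose_countable[OF _ e, where f = "\<lambda>a S. (\<Prod>i<m. ?e S i) * a"])
      show "(\<lambda>S. (\<Prod>i<m. ?e S i) * a) \<in> measurable (toeplitz_growing_space n) (count_space UNIV)" for a
        by (rule measurable_compose[OF Suc, where g = "\<lambda>b. b * a"]) simp
    qed
    then show ?case by (simp add: mult.commute)
  qed simp
  from this[of "Suc t"] show ?thesis by (simp add: pre_factorization_def lessThan_Suc_atMost)
qed

section \<open>The reduction to \<open>E1\<close>\<close>

instance bool :: second_countable_topology
proof
  show "\<exists>B :: bool set set. countable B \<and> open = generate_topology B"
  proof (intro exI conjI)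
    show "countable (UNIV :: bool set set)" by (simp add: countable_finite)
    show "open = generate_topology (UNIV :: bool set set)"
      by (auto simp: fun_eq_iff open_discrete intro: generate_topology.Basis)
  qed
qed

text \<open>Coordinate \<open>p\<close> is the set of realized patterns, indexed by \<open>p\<close>
  itself and empty when \<open>p\<close> is not a term, so that \<open>E1\<close> compares the large
  terms as well as the patterns.\<close>

definition conjugacy_code :: "(int \<Rightarrow> nat) set \<Rightarrow> nat \<Rightarrow> nat \<Rightarrow> bool" where
  "conjugacy_code S p j \<longleftrightarrow>
     p \<in> range (pre_factorization (scale S)) \<and> realizes p (lex_point S) (from_nat j)"

lemma measurable_conjugacy_code: "conjugacy_code \<in> borel_measurable (toeplitz_growing_space n)"
\<comment> \<open>Second countability of \<open>bool\<close> allows Borel measurability into the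
  product to be checked coordinatewise.\<close>
proof (intro measurable_coordinatewise_then_product)
  fix p j
  have [measurable]: "Measurable.pred (toeplitz_growing_space n) (\<lambda>S. p = pre_factorization (scale S) t)" for t
    by (rule measurable_compose[OF measurable_pre_factorization, where g = "\<lambda>b. p = b"]) simp
  have "Measurable.pred (toeplitz_growing_space n) (\<lambda>S. conjugacy_code S p j)"
    unfolding conjugacy_code_def image_iff Bex_def by measurable
  then show "(\<lambda>S. conjugacy_code S p j) \<in> borel_measurable (toeplitz_growing_space n)"
    by (rule measurable_compose[where g = "\<lambda>x. x"]) simp
qed

lemma conjugacy_code_eqD:
  assumes S: "S \<in> toeplitz_growing n" and T: "T \<in> toeplitz_growing n"
    and eq: "E1 (conjugacy_code S) (conjugacy_code T)"
  shows "top_conjugate S T"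
proof -
  note S' = toeplitz_growing_lex_point[OF S] and T' = toeplitz_growing_lex_point[OF T]
  obtain m where m: "\<And>p. p \<ge> m \<Longrightarrow> conjugacy_code S p = conjugacy_code T p"
    using eq by (auto simp: E1_def)
  obtain p s where p: "p > m" "p \<in> range (pre_factorization (scale S))" "block_start p (lex_point S) s"
    using ex_large_period_filled_block[OF S', of m] by (auto simp: block_start_def)
  have "conjugacy_code S p j = conjugacy_code T p j" for j using m[of p] p(1) by simp
  then have *: "realizes p (lex_point S) L \<longleftrightarrow> p \<in> range (pre_factorization (scale T)) \<and> realizes p (lex_point T) L" for L
    using p(2) unfolding conjugacy_code_def by (metis from_nat_to_nat)
  \<comment> \<open>The empty pattern is realized as soon as a cut exists; equality of the codes
    then makes \<open>p\<close> a term for \<open>T\<close>, so both points recognize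
    \<open>p\<close>.\<close>
  have "realizes p (lex_point S) []" using p(3) by (auto simp: realizes_def)
  then have "p \<in> range (pre_factorization (scale T))" using * by blast
  then have "recognizes (lex_point S) p" "recognizes (lex_point T) p" "p > 0"
    using recognizes_pre_factorization[OF S'] recognizes_pre_factorization[OF T'] p(1,2) by auto
  then show ?thesis using * p(3) by (intro top_conjugate_of_realizes[OF S'(1) T'(1) S'(2) T'(2)]) blast+
qed

text \<open>Equal scales give the same terms, and beyond both bounds \<open>B\<close> and
  \<open>C\<close> patterns transfer in both directions.\<close>

lemma conjugacy_code_eqI:
  assumes S: "S \<in> toeplitz_growing n" and T: "T \<in> toeplitz_growing n" and ST: "top_conjugate S T"
  shows "E1 (conjugacy_code S) (conjugacy_code T)"
proof -
  note S' = toeplitz_growing_lex_point[OF S] and T' = toeplitz_growing_lex_point[OF T]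
  have sc: "scale S = scale T" by (rule scale_eq_of_top_conjugate[OF S'(1) T'(1) ST])
  obtain B where B: "\<And>p L. p > B \<Longrightarrow> p \<in> range (pre_factorization (scale S)) \<Longrightarrow>
      realizes p (lex_point S) L \<Longrightarrow> realizes p (lex_point T) L"
    using top_conjugate_imp_realizes[OF S T'(1) ST S'(2) T'(2)] by blast
  obtain C where C: "\<And>p L. p > C \<Longrightarrow> p \<in> range (pre_factorization (scale T)) \<Longrightarrow>
      realizes p (lex_point T) L \<Longrightarrow> realizes p (lex_point S) L"
    using top_conjugate_imp_realizes[OF T S'(1) top_conjugate_sym[OF S'(1) ST] T'(2) S'(2)] by blast
  have "conjugacy_code S p = conjugacy_code T p" if "p \<ge> Suc (max B C)" for p
  proof
    fix j
    show "conjugacy_code S p j = conjugacy_code T p j"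
      using B[of p "from_nat j"] C[of p "from_nat j"] that sc by (auto simp: conjugacy_code_def)
  qed
  then show ?thesis unfolding E1_def by blast
qed

theorem theorem5p2:
  fixes n :: nat
  assumes "n \<ge> 2"
  shows "borel_reducible (toeplitz_growing_space n) top_conjugate
           (borel :: (nat \<Rightarrow> nat \<Rightarrow> bool) measure) E1"
  unfolding borel_reducible_def space_toeplitz_growing_space
  using measurable_conjugacy_code conjugacy_code_eqI conjugacy_code_eqD by blast

end
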